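(* Let $R$ be a commutative clean ring, let $n\ge 2$, and let $h\in R[t]$ be a monic polynomial of degree $n$. Then the following are equivalent: (1) Every $A\in \mathbf{M}_n(R)$ with characteristic polynomial $\chi(A)=h$ is strongly clean. (2) The companion matrix $C_h$ of $h$ is strongly clean. (3) There exists a gSRC-factorization of $h$ in $R[t]$.
   Context: All rings are unital. $\mathbf{M}_n(R)$ is the ring of $n\times n$ matrices over $R$, $\mathbf{U}(S)$ is the group of units of a ring $S$, and $\chi(A)$ is the characteristic polynomial of a square matrix $A$ over a commutative ring. An element $r$ of a ring $S$ is clean if $r=e+u$ with $e\in S$ idempotent and $u\in\mathbf{U}(S)$; it is strongly clean if $e,u$ can be chosen with in addition $eu=ue$. A ring is (strongly) clean if each of its elements is (strongly) clean. For a commutative ring $S$ and a monic $f\in S[t]$, a factorization $f=f_0f_1$ into monic polynomials of $S[t]$ is an SR-factorization if $f_0(0)\in\mathbf{U}(S)$ and $f_1(1)\in\mathbf{U}(S)$; it is an SRC-factorization if in addition the ideal $(f_0,f_1)$ equals $S[t]$. A complete orthogonal set of idempotents of $R$ is a finite set of pairwise orthogonal idempotents of $R$ whose sum is $1$. A monic $h\in R[t]$ of degree $\ge 1$ has a gSRC-factorization if there is a complete orthogonal set of idempotents $\{e_1,\ldots,e_k\}$ of $R$, depending on $h$, such that for each $i=1,\ldots,k$ the polynomial $he_i$ has an SRC-factorization in $e_iR[t]$ (where $e_iR$ is regarded as a ring with identity $e_i$). *)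

theory Defs
  imports "Jordan_Normal_Form.Char_Poly" "Jordan_Normal_Form.VS_Connect" "HOL-Algebra.Ideal"
begin

definition idempotent_in :: "('s, 'b) ring_scheme \<Rightarrow> 's \<Rightarrow> bool" where
  "idempotent_in S e \<longleftrightarrow> e \<in> carrier S \<and> e \<otimes>\<^bsub>S\<^esub> e = e"

definition clean_in :: "('s, 'b) ring_scheme \<Rightarrow> 's \<Rightarrow> bool" where
  "clean_in S r \<longleftrightarrow> (\<exists>e u. idempotent_in S e \<and> u \<in> Units S \<and> r = e \<oplus>\<^bsub>S\<^esub> u)"

definition strongly_clean_in :: "('s, 'b) ring_scheme \<Rightarrow> 's \<Rightarrow> bool" where
  "strongly_clean_in S r \<longleftrightarrow>
     (\<exists>e u. idempotent_in S e \<and> u \<in> Units S \<and> r = e \<oplus>\<^bsub>S\<^esub> u \<and>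
            e \<otimes>\<^bsub>S\<^esub> u = u \<otimes>\<^bsub>S\<^esub> e)"

definition clean_ring :: "('s, 'b) ring_scheme \<Rightarrow> bool" where
  "clean_ring S \<longleftrightarrow> ring S \<and> (\<forall>r \<in> carrier S. clean_in S r)"

text \<open>For an idempotent \<open>e\<close> of \<open>R\<close>, the ring \<open>e R\<close> with identity \<open>e\<close>. Since the constant
  polynomial \<open>[:e:]\<close> is an idempotent of \<open>R[t]\<close> and \<open>[:e:] R[t]\<close> consists of the polynomials
  with all coefficients in \<open>e R\<close>, the ring \<open>(e R)[t]\<close> is \<open>corner_ring [:e:]\<close>.\<close>

definition corner_ring :: "'a::comm_ring_1 \<Rightarrow> 'a ring" where
  "corner_ring e = \<lparr>carrier = range ((*) e), mult = (*), one = e, zero = 0, add = (+)\<rparr>"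

abbreviation corner_poly_ring :: "'a::comm_ring_1 \<Rightarrow> 'a poly ring" where
  "corner_poly_ring e \<equiv> corner_ring [:e:]"

text \<open>Monic means leading coefficient \<open>e\<close>, the identity of \<open>e R\<close>. For \<open>e = 0\<close> the only
  polynomial over the zero ring, \<open>0\<close>, is thereby monic, as \<open>lead_coeff 0 = 0\<close>.\<close>

definition corner_monic :: "'a::comm_ring_1 \<Rightarrow> 'a poly \<Rightarrow> bool" where
  "corner_monic e f \<longleftrightarrow> f \<in> carrier (corner_poly_ring e) \<and> lead_coeff f = e"

text \<open>Factorizations over the commutative ring \<open>S = e R\<close>; the case \<open>S = R\<close> is \<open>e = 1\<close>.
  The value of \<open>f\<^sub>1\<close> at the identity of \<open>S\<close> is \<open>poly f\<^sub>1 e\<close>.\<close>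

definition SR_factorization :: "'a::comm_ring_1 \<Rightarrow> 'a poly \<Rightarrow> 'a poly \<Rightarrow> 'a poly \<Rightarrow> bool" where
  "SR_factorization e f f\<^sub>0 f\<^sub>1 \<longleftrightarrow>
     corner_monic e f \<and> corner_monic e f\<^sub>0 \<and> corner_monic e f\<^sub>1 \<and> f = f\<^sub>0 * f\<^sub>1 \<and>
     poly f\<^sub>0 0 \<in> Units (corner_ring e) \<and> poly f\<^sub>1 e \<in> Units (corner_ring e)"

definition SRC_factorization :: "'a::comm_ring_1 \<Rightarrow> 'a poly \<Rightarrow> 'a poly \<Rightarrow> 'a poly \<Rightarrow> bool" where
  "SRC_factorization e f f\<^sub>0 f\<^sub>1 \<longleftrightarrow>
     SR_factorization e f f\<^sub>0 f\<^sub>1 \<and>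
     genideal (corner_poly_ring e) {f\<^sub>0, f\<^sub>1} = carrier (corner_poly_ring e)"

definition complete_orthogonal_idempotents :: "'a::comm_ring_1 set \<Rightarrow> bool" where
  "complete_orthogonal_idempotents I \<longleftrightarrow>
     finite I \<and> (\<forall>e \<in> I. e * e = e) \<and> (\<forall>e \<in> I. \<forall>e' \<in> I. e \<noteq> e' \<longrightarrow> e * e' = 0) \<and>
     (\<Sum>e\<in>I. e) = 1"

definition has_gSRC_factorization :: "'a::comm_ring_1 poly \<Rightarrow> bool" where
  "has_gSRC_factorization h \<longleftrightarrow>
     (\<exists>I. complete_orthogonal_idempotents I \<and>
          (\<forall>e \<in> I. \<exists>f\<^sub>0 f\<^sub>1. SRC_factorization e (Polynomial.smult e h) f\<^sub>0 f\<^sub>1))"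

definition companion_mat :: "'a::comm_ring_1 poly \<Rightarrow> 'a mat" where
  "companion_mat h = mat (degree h) (degree h)
     (\<lambda>(i, j). if j = degree h - 1 then - coeff h i else if i = j + 1 then 1 else 0)"

lemma carrier_corner_ring:
  fixes e :: "'a::comm_ring_1"
  assumes "e * e = e"
  shows "carrier (corner_ring e) = {x. e * x = x}"
proof -
  have "e * (e * x) = e * x" for x
    using assms by (metis mult.assoc)
  then show ?thesis
    by (auto simp: corner_ring_def) (metis rangeI)
qed

lemma cring_corner_ring:
  fixes e :: "'a::comm_ring_1"
  assumes e: "e * e = e"
  shows "cring (corner_ring e)"
proof -
  have c: "x \<in> carrier (corner_ring e) \<longleftrightarrow> e * x = x" for x
    by (simp add: carrier_corner_ring[OF e])
  have o: "x \<oplus>\<^bsub>corner_ring e\<^esub> y = x + y" "x \<otimes>\<^bsub>corner_ring e\<^esub> y = x * y"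
    "\<one>\<^bsub>corner_ring e\<^esub> = e" "\<zero>\<^bsub>corner_ring e\<^esub> = 0" for x y
    by (simp_all add: corner_ring_def)
  show ?thesis
  proof (intro cringI abelian_groupI comm_monoidI)
    fix x y assume "x \<in> carrier (corner_ring e)" "y \<in> carrier (corner_ring e)"
    then show "x \<otimes>\<^bsub>corner_ring e\<^esub> y \<in> carrier (corner_ring e)"
      unfolding c o by (metis mult.assoc)
  next
    fix x assume "x \<in> carrier (corner_ring e)"
    then show "\<exists>y\<in>carrier (corner_ring e). y \<oplus>\<^bsub>corner_ring e\<^esub> x = \<zero>\<^bsub>corner_ring e\<^esub>"
      unfolding Bex_def c o by (intro exI[of _ "- x"]) simp
  qed (simp_all add: c o e algebra_simps)
qed

lemma carrier_corner_poly_ring: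
  fixes e :: "'a::comm_ring_1"
  assumes e: "e * e = e"
  shows "carrier (corner_poly_ring e) = {f. \<forall>k. coeff f k \<in> carrier (corner_ring e)}"
proof -
  have "[:e:] * [:e:] = [:e:]"
    by (simp add: e)
  then show ?thesis
    by (simp add: carrier_corner_ring e poly_eq_iff)
qed

end

theory Submission
  imports Defs "HOL-Computational_Algebra.Formal_Laurent_Series"
begin

text \<open>
  The three conditions are all equivalent to a statement about the commutative ring
  \<open>R[t]/(h)\<close>: its element \<open>t\<close> is a sum of an idempotent and a unit. The proof goes round the
  cycle (3) \<open>\<Longrightarrow>\<close> (1) \<open>\<Longrightarrow>\<close> (2) \<open>\<Longrightarrow>\<close> (3).

  (3) \<open>\<Longrightarrow>\<close> (1). Adding up the factors \<open>f\<^sub>0\<close> and \<open>f\<^sub>1\<close> over the orthogonal idempotents gives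
  \<open>h = F\<^sub>0 F\<^sub>1\<close> over \<open>R\<close> with \<open>F\<^sub>0\<close>, \<open>F\<^sub>1\<close> comaximal and \<open>F\<^sub>0(0)\<close>, \<open>F\<^sub>1(1)\<close> units
  (\<open>clean_variable_mod_if_gSRC\<close>). By the Chinese remainder theorem there is an idempotent of
  \<open>R[t]/(h)\<close> that is \<open>0\<close> modulo \<open>F\<^sub>0\<close> and \<open>1\<close> modulo \<open>F\<^sub>1\<close>; subtracting it from \<open>t\<close> leaves \<open>t\<close>
  modulo \<open>F\<^sub>0\<close> and \<open>t - 1\<close> modulo \<open>F\<^sub>1\<close>, both of which are units there
  (\<open>clean_variable_mod_if_comaximal\<close>). If \<open>\<chi>(A) = h\<close>, then \<open>h(A) = 0\<close> by the Cayley-Hamilton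
  theorem, so evaluation at \<open>A\<close> carries the decomposition of \<open>t\<close> to one of \<open>A\<close>, whose two
  terms commute because they are polynomials in \<open>A\<close>.

  (1) \<open>\<Longrightarrow>\<close> (2) holds because \<open>\<chi>(C\<^sub>h) = h\<close>.

  (2) \<open>\<Longrightarrow>\<close> (3). Let \<open>C = C\<^sub>h = E + U\<close> with \<open>E\<close> idempotent and \<open>U\<close> invertible, commuting with each
  other, and put \<open>Q = 1 - E\<close>. The factors of \<open>h\<close> are the characteristic polynomials of \<open>C\<close> on
  the images of \<open>Q\<close> and \<open>E\<close>. These images are projective modules that may have neither a basis nor
  a constant rank, so the polynomials are written as determinants of full size,
  \<open>F\<^sub>0 = det ((t - C) Q + (1 - Q))\<close> and \<open>F\<^sub>1 = det ((t - C) E + (1 - E))\<close>. Four facts make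
  this a gSRC-factorization.

  \<^item> The coefficients of \<open>det (t Q + (1 - Q))\<close> form a complete orthogonal set of idempotents; the
    \<open>i\<close>-th one cuts out the part of \<open>R\<close> over which \<open>Q\<close> has rank \<open>i\<close>, and there \<open>F\<^sub>0\<close> is monic
    of degree \<open>i\<close> (\<open>complete_orthogonal_rank_idempotents\<close>, \<open>coeff_rank_component\<close>).
  \<^item> The two matrices multiply to \<open>t - C\<close>, hence \<open>F\<^sub>0 F\<^sub>1 = h\<close>, and \<open>F\<^sub>1\<close> is then monic over
    each part as well (\<open>pencil_det_mult_complement\<close>, \<open>corner_monic_cofactor\<close>).
  \<^item> \<open>F\<^sub>0(0)\<close> and \<open>F\<^sub>1(1)\<close> divide the unit \<open>det (-U)\<close>, because \<open>C = U\<close> on the image of \<open>Q\<close> and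
    \<open>C - 1 = U\<close> on the image of \<open>E\<close> (\<open>pencil_det_unit\<close>).
  \<^item> Let \<open>\<epsilon>\<close> be the polynomial with the first column of \<open>E\<close> as coefficients. A Cayley-Hamilton
    argument on each image shows that \<open>h\<close> divides \<open>F\<^sub>0 (1 - \<epsilon>)\<close> and \<open>F\<^sub>1 \<epsilon>\<close>
    (\<open>companion_dvd_pencil_det\<close>). Cancelling the monic factors, \<open>F\<^sub>1\<close> divides \<open>1 - \<epsilon>\<close> and \<open>F\<^sub>0\<close>
    divides \<open>\<epsilon>\<close>, so the two are comaximal.
\<close>

section \<open>Evaluating polynomials at a matrix\<close>

text \<open>
  Square matrices of a fixed size do not form a type of class \<open>comm_ring_1\<close> or \<open>ring_1\<close>, so
  evaluation at a matrix is defined by Horner's rule and its homomorphism laws are proved by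
  induction on the polynomial.
\<close>

definition poly_mat :: "'a::comm_ring_1 mat \<Rightarrow> 'a poly \<Rightarrow> 'a mat" where
  "poly_mat A p = fold_coeffs (\<lambda>c M. c \<cdot>\<^sub>m 1\<^sub>m (dim_row A) + A * M) p (0\<^sub>m (dim_row A) (dim_row A))"

context
  fixes A :: "'a::comm_ring_1 mat" and n :: nat
  assumes A: "A \<in> carrier_mat n n"
begin

lemma poly_mat_0 [simp]: "poly_mat A 0 = 0\<^sub>m n n"
  using A by (simp add: poly_mat_def)

lemma poly_mat_pCons [simp]: "poly_mat A (pCons c p) = c \<cdot>\<^sub>m 1\<^sub>m n + A * poly_mat A p"
proof (cases "p = 0 \<and> c = 0")
  case True
  have "0 \<cdot>\<^sub>m 1\<^sub>m n = (0\<^sub>m n n :: 'a mat)" by auto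
  with True show ?thesis using A by simp
next
  case False
  then show ?thesis using A by (auto simp: poly_mat_def)
qed

lemma poly_mat_carrier [simp]: "poly_mat A p \<in> carrier_mat n n"
  using A by (induction p) auto

lemma poly_mat_dim [simp]: "dim_row (poly_mat A p) = n" "dim_col (poly_mat A p) = n"
  using poly_mat_carrier[of p] by (auto simp del: poly_mat_carrier)

lemma poly_mat_add: "poly_mat A (p + q) = poly_mat A p + poly_mat A q"
proof (induction p q rule: poly_induct2)
  case (pCons a p b q)
  have "A * (poly_mat A p + poly_mat A q) = A * poly_mat A p + A * poly_mat A q"
    using A by (intro mult_add_distrib_mat) auto
  then show ?case using A pCons
    by (auto intro!: eq_matI simp: algebra_simps simp del: index_mult_mat(1))
qed simp

lemma poly_mat_smult: "poly_mat A (Polynomial.smult c p) = c \<cdot>\<^sub>m poly_mat A p"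
proof (induction p)
  case (pCons a p)
  have "A * (c \<cdot>\<^sub>m poly_mat A p) = c \<cdot>\<^sub>m (A * poly_mat A p)"
    using A by (intro mult_smult_distrib) auto
  with pCons show ?case using A
    by (auto intro!: eq_matI simp: algebra_simps simp del: index_mult_mat(1))
qed (use A in auto)

lemma poly_mat_mult: "poly_mat A (p * q) = poly_mat A p * poly_mat A q"
proof (induction p)
  case (pCons a p)
  have "poly_mat A (pCons a p * q) = a \<cdot>\<^sub>m poly_mat A q + (0 \<cdot>\<^sub>m 1\<^sub>m n + A * (poly_mat A p * poly_mat A q))"
    by (simp add: poly_mat_add poly_mat_smult pCons.IH)
  also have "\<dots> = a \<cdot>\<^sub>m poly_mat A q + (A * poly_mat A p) * poly_mat A q"
    using A by (auto intro!: eq_matI simp del: index_mult_mat(1) simp: assoc_mult_mat[of A n n _ n _ n])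
  also have "\<dots> = (a \<cdot>\<^sub>m 1\<^sub>m n) * poly_mat A q + (A * poly_mat A p) * poly_mat A q"
    using A by (subst mult_smult_assoc_mat[of _ n n _ n]) auto
  also have "\<dots> = (a \<cdot>\<^sub>m 1\<^sub>m n + A * poly_mat A p) * poly_mat A q"
    using A by (intro add_mult_distrib_mat[symmetric]) auto
  finally show ?case by simp
qed simp

lemma poly_mat_const: "poly_mat A [:c:] = c \<cdot>\<^sub>m 1\<^sub>m n"
  using A by (auto intro!: eq_matI)

lemma poly_mat_1: "poly_mat A 1 = 1\<^sub>m n"
  using A poly_mat_const[of 1] by (auto intro!: eq_matI simp: one_pCons simp del: poly_mat_pCons)

lemma poly_mat_X: "poly_mat A [:0, 1:] = A"
proof -
  have "poly_mat A [:1:] = 1\<^sub>m n"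
    using poly_mat_1 by (simp only: one_pCons)
  then have "poly_mat A [:0, 1:] = 0 \<cdot>\<^sub>m 1\<^sub>m n + A"
    using A by (simp only: poly_mat_pCons[of 0] right_mult_one_mat[OF A])
  then show ?thesis using A by (auto intro!: eq_matI)
qed

lemma poly_mat_commute: "poly_mat A p * poly_mat A q = poly_mat A q * poly_mat A p"
  by (metis poly_mat_mult mult.commute)

lemma poly_mat_sum:
  "finite I \<Longrightarrow> i < n \<Longrightarrow> j < n \<Longrightarrow> poly_mat A (\<Sum>k\<in>I. f k) $$ (i, j) = (\<Sum>k\<in>I. poly_mat A (f k) $$ (i, j))"
  by (induction I rule: finite_induct) (auto simp: poly_mat_add)

text \<open>
  Let \<open>R[t]\<close> act on \<open>R\<^sup>n\<close> through \<open>A\<close>, and let \<open>b\<^sub>j\<close> be the standard basis. A polynomial matrix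
  \<open>M\<close> sends its \<open>k\<close>-th column to the vector \<open>\<Sum>\<^sub>j M\<^sub>j\<^sub>k b\<^sub>j\<close>, whose \<open>a\<close>-th entry is
  \<open>\<Sum>\<^sub>j (M\<^sub>j\<^sub>k(A))\<^sub>a\<^sub>j\<close>. This map kills every multiple \<open>(t - A) Y\<close>, as \<open>A\<close> commutes with each \<open>Y\<^sub>l\<^sub>k(A)\<close>.
  Taking for \<open>Y\<close> the adjugate of \<open>t - A\<close> makes the multiple \<open>\<chi>(A)\<close> times the identity matrix.
\<close>

lemma cayley_hamilton: "poly_mat A (char_poly A) = 0\<^sub>m n n"
proof -
  let ?X = "char_poly_matrix A" and ?h = "char_poly A"
  define Y where "Y = adj_mat ?X"
  have X: "?X \<in> carrier_mat n n" using A by simp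
  have Y: "Y \<in> carrier_mat n n" and XY: "?X * Y = ?h \<cdot>\<^sub>m 1\<^sub>m n"
    using adj_mat[OF X] by (auto simp: Y_def char_poly_def)
  have Xe: "?X $$ (j, l) = (if j = l then [:0, 1:] else 0) - [:A $$ (j, l):]" if "j < n" "l < n" for j l
    using that A by (auto simp: char_poly_matrix_def)
  show ?thesis
  proof (rule eq_matI)
    fix a k assume ak: "a < dim_row (0\<^sub>m n n :: 'a mat)" "k < dim_col (0\<^sub>m n n :: 'a mat)"
    then have a: "a < n" and k: "k < n" by auto
    let ?P = "\<lambda>p i j. poly_mat A p $$ (i, j)"
    \<comment> \<open>only the term \<open>j = k\<close> survives, since \<open>?X * Y\<close> is scalar\<close>
    have "?P ?h a k = (\<Sum>j<n. ?P ((?X * Y) $$ (j, k)) a j)"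
    proof -
      have "(?X * Y) $$ (j, k) = (if j = k then ?h else 0)" if "j < n" for j
        using that k by (auto simp: XY)
      then have "(\<Sum>j<n. ?P ((?X * Y) $$ (j, k)) a j) = (\<Sum>j<n. if j = k then ?P ?h a j else 0)"
        using a by (intro sum.cong) auto
      then show ?thesis using k by simp
    qed
    also have "\<dots> = (\<Sum>j<n. (\<Sum>l<n. ?P (Y $$ (j, k)) a l * A $$ (l, j)) - (\<Sum>l<n. A $$ (j, l) * ?P (Y $$ (l, k)) a j))"
    proof (rule sum.cong)
      fix j assume "j \<in> {..<n}"
      then have j: "j < n" by simp
      have "(?X * Y) $$ (j, k) = (\<Sum>l<n. ?X $$ (j, l) * Y $$ (l, k))"
        using X Y j k by (simp add: scalar_prod_def lessThan_atLeast0)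
      also have "\<dots> = (\<Sum>l<n. (if l = j then [:0, 1:] * Y $$ (l, k) else 0) + Polynomial.smult (- A $$ (j, l)) (Y $$ (l, k)))"
        using j by (intro sum.cong) (auto simp: Xe algebra_simps)
      also have "\<dots> = [:0, 1:] * Y $$ (j, k) + (\<Sum>l<n. Polynomial.smult (- A $$ (j, l)) (Y $$ (l, k)))"
        using j by (subst sum.distrib) simp
      finally have "?P ((?X * Y) $$ (j, k)) a j =
          ?P ([:0, 1:] * Y $$ (j, k)) a j + (\<Sum>l<n. - A $$ (j, l) * ?P (Y $$ (l, k)) a j)"
        using a j by (simp add: poly_mat_add poly_mat_sum poly_mat_smult del: poly_mat_pCons mult_pCons_left smult_minus_left)
      moreover have "poly_mat A ([:0, 1:] * Y $$ (j, k)) = poly_mat A (Y $$ (j, k)) * A"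
        using poly_mat_mult[of "Y $$ (j, k)" "[:0, 1:]"] unfolding poly_mat_X by (metis mult.commute)
      moreover have "(poly_mat A (Y $$ (j, k)) * A) $$ (a, j) = (\<Sum>l<n. ?P (Y $$ (j, k)) a l * A $$ (l, j))"
        using A a j by (simp add: scalar_prod_def lessThan_atLeast0)
      ultimately show "?P ((?X * Y) $$ (j, k)) a j =
          (\<Sum>l<n. ?P (Y $$ (j, k)) a l * A $$ (l, j)) - (\<Sum>l<n. A $$ (j, l) * ?P (Y $$ (l, k)) a j)"
        by (simp add: sum_negf)
    qed simp
    also have "\<dots> = 0"
      unfolding sum_subtractf
      by (subst (2) sum.swap) (simp add: mult.commute)
    finally show "?P ?h a k = 0\<^sub>m n n $$ (a, k)" using a k by simp
  qed auto
qed

end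

section \<open>Comaximal factors make the variable strongly clean modulo their product\<close>

text \<open>
  Modulo \<open>t - c\<close> the polynomial \<open>F\<close> is its value at \<open>c\<close>; so if that value is a unit, then \<open>t - c\<close>
  is a unit modulo \<open>F\<close>.
\<close>

lemma unit_value_comaximal:
  fixes F :: "'a::comm_ring_1 poly"
  assumes "poly F c dvd 1"
  obtains r s where "[:-c, 1:] * r + F * s = 1"
proof -
  obtain w where w: "poly F c * w = 1" using assms by (metis dvdE)
  define L W where "L = [:-c, 1:]" and "W = [:w:]"
  have "L * (- W * synthetic_div F c) + F * W = W * (F - L * synthetic_div F c)"
    by (simp add: algebra_simps)
  also have "\<dots> = W * [:poly F c:]"
    using synthetic_div_correct'[of c F] unfolding L_def by (metis add_diff_cancel_left')
  also have "\<dots> = 1" using w by (simp add: W_def mult.commute one_pCons)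
  finally show ?thesis unfolding L_def by (rule that)
qed

text \<open>
  The class of \<open>t\<close> in \<open>R[t]/(h)\<close> is the sum of the idempotent \<open>\<epsilon>\<close> and a unit with inverse \<open>v\<close>.
  Representatives in \<open>R[t]\<close> replace the quotient ring, so that they can be evaluated at a matrix.
\<close>

definition clean_variable_mod :: "'a::comm_ring_1 poly \<Rightarrow> bool" where
  "clean_variable_mod h \<longleftrightarrow> (\<exists>\<epsilon> v. h dvd \<epsilon> * \<epsilon> - \<epsilon> \<and> h dvd ([:0, 1:] - \<epsilon>) * v - 1)"

text \<open>
  The idempotent is \<open>\<epsilon> = a F\<^sub>0\<close>, which is \<open>0\<close> modulo \<open>F\<^sub>0\<close> and \<open>1\<close> modulo \<open>F\<^sub>1\<close>. So \<open>t - \<epsilon>\<close> is \<open>t\<close>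
  modulo \<open>F\<^sub>0\<close>, with inverse \<open>p\<close>, and \<open>t - 1\<close> modulo \<open>F\<^sub>1\<close>, with inverse \<open>r\<close>; the inverse
  \<open>p (1 - \<epsilon>) + r \<epsilon>\<close> modulo \<open>F\<^sub>0 F\<^sub>1\<close> interpolates the two.
\<close>

lemma clean_variable_mod_if_comaximal:
  fixes F\<^sub>0 F\<^sub>1 :: "'a::comm_ring_1 poly"
  assumes ab: "a * F\<^sub>0 + b * F\<^sub>1 = 1"
    and F0: "poly F\<^sub>0 0 dvd 1" and F1: "poly F\<^sub>1 1 dvd 1"
  shows "clean_variable_mod (F\<^sub>0 * F\<^sub>1)"
proof -
  define X :: "'a poly" where "X = [:0, 1:]"
  obtain p p' where "[:-0, 1:] * p + F\<^sub>0 * p' = 1" by (rule unit_value_comaximal[OF F0])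
  then have p: "X * p = 1 - F\<^sub>0 * p'" by (simp add: X_def algebra_simps)
  obtain r r' where "[:-1, 1:] * r + F\<^sub>1 * r' = 1" by (rule unit_value_comaximal[OF F1])
  moreover have "[:-1, 1:] = X - 1" by (simp add: X_def one_pCons)
  ultimately have r: "(X - 1) * r = 1 - F\<^sub>1 * r'" by (simp add: algebra_simps)
  define \<epsilon> where "\<epsilon> = a * F\<^sub>0"
  have \<epsilon>': "1 - \<epsilon> = b * F\<^sub>1" using ab by (simp add: \<epsilon>_def algebra_simps)
  have "\<epsilon> * \<epsilon> - \<epsilon> = F\<^sub>0 * F\<^sub>1 * (- a * b)"
  proof -
    have "\<epsilon> * \<epsilon> - \<epsilon> = - \<epsilon> * (1 - \<epsilon>)" by (simp add: algebra_simps)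
    then show ?thesis unfolding \<epsilon>' by (simp add: \<epsilon>_def algebra_simps)
  qed
  moreover have "F\<^sub>0 * F\<^sub>1 dvd (X - \<epsilon>) * (p * (1 - \<epsilon>) + r * \<epsilon>) - 1"
  proof -
    \<comment> \<open>each summand on the right contains one multiple of \<open>F\<^sub>0\<close> and one of \<open>F\<^sub>1\<close>\<close>
    have "(X - \<epsilon>) * (p * (1 - \<epsilon>) + r * \<epsilon>) - 1 =
        (X * p - 1) * (1 - \<epsilon>) + ((X - 1) * r - 1) * \<epsilon> + \<epsilon> * (1 - \<epsilon>) * (r - p)"
      by (simp add: algebra_simps)
    also have "\<dots> = F\<^sub>0 * F\<^sub>1 * (- p' * b - r' * a + a * b * (r - p))"
      unfolding p r \<epsilon>' by (simp add: \<epsilon>_def algebra_simps)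
    finally show ?thesis by (metis dvd_triv_left)
  qed
  ultimately show ?thesis unfolding clean_variable_mod_def X_def by (metis dvd_triv_left)
qed

lemma ring_mat_UnitsI:
  fixes U V :: "'a::comm_ring_1 mat"
  assumes "U \<in> carrier_mat n n" "V \<in> carrier_mat n n" "U * V = 1\<^sub>m n" "V * U = 1\<^sub>m n"
  shows "U \<in> Units (ring_mat TYPE('a) n ())"
  using assms by (auto simp: Units_def ring_mat_simps)

lemma strongly_clean_if_clean_variable_mod:
  fixes A :: "'a::comm_ring_1 mat"
  assumes A: "A \<in> carrier_mat n n" and h: "clean_variable_mod (char_poly A)"
  shows "strongly_clean_in (ring_mat TYPE('a) n ()) A"
proof -
  note P = poly_mat_carrier[OF A]
  \<comment> \<open>congruent polynomials modulo the characteristic polynomial agree at \<open>A\<close>\<close>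
  have ev0: "poly_mat A p = poly_mat A q" if dvd: "char_poly A dvd p - q" for p q
  proof -
    obtain g where "p - q = char_poly A * g" using dvd by blast
    then have "p = char_poly A * g + q" by (simp add: algebra_simps)
    then show ?thesis
      by (simp add: poly_mat_add[OF A] poly_mat_mult[OF A] cayley_hamilton[OF A]
          left_mult_zero_mat[OF P] left_add_zero_mat[OF P])
  qed
  from h obtain \<epsilon> v where e: "char_poly A dvd \<epsilon> * \<epsilon> - \<epsilon>"
    and v: "char_poly A dvd ([:0, 1:] - \<epsilon>) * v - 1"
    unfolding clean_variable_mod_def by blast
  define E U V where "E = poly_mat A \<epsilon>" and "U = poly_mat A ([:0, 1:] - \<epsilon>)" and "V = poly_mat A v"
  have E: "E \<in> carrier_mat n n" and U: "U \<in> carrier_mat n n" and V: "V \<in> carrier_mat n n"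
    unfolding E_def U_def V_def by (rule P)+
  have "E * E = E" using ev0[OF e] by (simp add: E_def poly_mat_mult[OF A])
  moreover have UV: "U * V = 1\<^sub>m n"
    using ev0[OF v] unfolding U_def V_def poly_mat_mult[OF A] poly_mat_1[OF A] .
  moreover have "V * U = 1\<^sub>m n"
    using UV poly_mat_commute[OF A] unfolding U_def V_def by metis
  moreover have "E + U = A"
    using poly_mat_add[OF A, of \<epsilon> "[:0, 1:] - \<epsilon>"] poly_mat_X[OF A] unfolding E_def U_def by simp
  moreover have "E * U = U * E"
    unfolding E_def U_def by (rule poly_mat_commute[OF A])
  ultimately show ?thesis
    unfolding strongly_clean_in_def idempotent_in_def
    using E ring_mat_UnitsI[OF U V] by (intro exI[of _ E] exI[of _ U]) (auto simp: ring_mat_simps)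
qed

section \<open>Factorizations over a corner ring\<close>

lemma Units_corner_ring_iff:
  fixes e :: "'a::comm_ring_1"
  assumes "e * e = e"
  shows "x \<in> Units (corner_ring e) \<longleftrightarrow> e * x = x \<and> (\<exists>y. e * y = y \<and> x * y = e)"
proof -
  have "x \<in> Units (corner_ring e) \<longleftrightarrow> x \<in> carrier (corner_ring e) \<and>
      (\<exists>y \<in> carrier (corner_ring e). y * x = e \<and> x * y = e)"
    by (auto simp: Units_def corner_ring_def)
  then show ?thesis by (auto simp: carrier_corner_ring[OF assms] mult.commute)
qed

lemma corner_ring_comaximal_iff:
  fixes c :: "'a::comm_ring_1"
  assumes c: "c * c = c" and f: "c * f = f" and g: "c * g = g"
  shows "genideal (corner_ring c) {f, g} = carrier (corner_ring c) \<longleftrightarrow> (\<exists>a b. a * f + b * g = c)"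
proof
  let ?R = "corner_ring c"
  interpret cring ?R by (rule cring_corner_ring[OF c])
  have o: "x \<oplus>\<^bsub>?R\<^esub> y = x + y" "x \<otimes>\<^bsub>?R\<^esub> y = x * y" "\<one>\<^bsub>?R\<^esub> = c" "\<zero>\<^bsub>?R\<^esub> = 0" for x y
    by (simp_all add: corner_ring_def)
  have fg: "f \<in> carrier ?R" "g \<in> carrier ?R" using f g by (simp_all add: carrier_corner_ring[OF c])
  {
    assume G: "genideal ?R {f, g} = carrier ?R"
    let ?J = "PIdl\<^bsub>?R\<^esub> f <+>\<^bsub>?R\<^esub> PIdl\<^bsub>?R\<^esub> g"
    have J: "ideal ?J ?R" using fg by (intro add_ideals cgenideal_ideal)
    have "f \<oplus>\<^bsub>?R\<^esub> \<zero>\<^bsub>?R\<^esub> \<in> ?J"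
      unfolding set_add_def' using cgenideal_self[OF fg(1)] ideal.Icarr[OF cgenideal_ideal[OF fg(2)]]
        additive_subgroup.zero_closed[OF ideal.axioms(1)[OF cgenideal_ideal[OF fg(2)]]] by blast
    moreover have "\<zero>\<^bsub>?R\<^esub> \<oplus>\<^bsub>?R\<^esub> g \<in> ?J"
      unfolding set_add_def' using cgenideal_self[OF fg(2)]
        additive_subgroup.zero_closed[OF ideal.axioms(1)[OF cgenideal_ideal[OF fg(1)]]] by blast
    ultimately have "{f, g} \<subseteq> ?J" by (simp add: o)
    then have "genideal ?R {f, g} \<subseteq> ?J" by (rule genideal_minimal[OF J])
    then have "c \<in> ?J" using G one_closed by (auto simp: o)
    then show "\<exists>a b. a * f + b * g = c"
      by (auto simp: set_add_def' cgenideal_def o)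
  }
  {
    assume "\<exists>a b. a * f + b * g = c"
    then obtain a b where ab: "a * f + b * g = c" by blast
    have I: "ideal (genideal ?R {f, g}) ?R" using fg by (intro genideal_ideal) auto
    have fgI: "f \<in> genideal ?R {f, g}" "g \<in> genideal ?R {f, g}"
      using genideal_self[of "{f, g}"] fg by auto
    have "c * a \<in> carrier ?R" "c * b \<in> carrier ?R"
      by (simp_all add: carrier_corner_ring[OF c] mult.assoc[symmetric] c)
    then have "(c * a) \<otimes>\<^bsub>?R\<^esub> f \<oplus>\<^bsub>?R\<^esub> (c * b) \<otimes>\<^bsub>?R\<^esub> g \<in> genideal ?R {f, g}"
      using fgI by (intro additive_subgroup.a_closed[OF ideal.axioms(1)[OF I]] ideal.I_l_closed[OF I])
    moreover have "(c * a) * f + (c * b) * g = c"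
    proof -
      have "(c * a) * f + (c * b) * g = c * (a * f + b * g)" by (simp add: algebra_simps)
      then show ?thesis by (simp add: ab c)
    qed
    ultimately have "\<one>\<^bsub>?R\<^esub> \<in> genideal ?R {f, g}" by (simp add: o)
    then show "genideal ?R {f, g} = carrier ?R" by (rule ideal.one_imp_carrier[OF I])
  }
qed

text \<open>
  The difference \<open>f(1) - f(e)\<close> is a multiple of \<open>1 - e\<close>, and also of \<open>e\<close> because \<open>f\<close> is. As
  \<open>e\<close> is idempotent, it vanishes.
\<close>

lemma poly_at_corner_identity:
  fixes e :: "'a::comm_ring_1"
  assumes e: "e * e = e" and f: "Polynomial.smult e f = f"
  shows "poly f e = poly f 1"
proof -
  have "poly ([:-e, 1:] * synthetic_div f e + [:poly f e:]) 1 = poly f 1"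
    by (simp only: synthetic_div_correct')
  then have f1: "poly f 1 = (1 - e) * poly (synthetic_div f e) 1 + poly f e" by (simp add: algebra_simps)
  have "e * poly f 1 = (e - e * e) * poly (synthetic_div f e) 1 + e * poly f e"
    unfolding f1 by (simp add: algebra_simps)
  moreover have "e * poly f z = poly f z" for z using arg_cong[OF f, of "\<lambda>p. poly p z"] by simp
  ultimately show ?thesis by (simp add: e)
qed

lemma const_poly_idempotent: "(e::'a::comm_ring_1) * e = e \<Longrightarrow> [:e:] * [:e:] = [:e:]"
  by simp

lemma corner_monic_iff:
  fixes e :: "'a::comm_ring_1"
  assumes "e * e = e"
  shows "corner_monic e f \<longleftrightarrow> Polynomial.smult e f = f \<and> lead_coeff f = e"
  unfolding corner_monic_def carrier_corner_ring[OF const_poly_idempotent[OF assms]] by simp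

text \<open>
  This eliminates the corner rings: units of \<open>e R\<close> and comaximality over \<open>e R\<close> are equations
  in \<open>R\<close> and \<open>R[t]\<close> with \<open>e\<close> in place of \<open>1\<close>.
\<close>

lemma SRC_factorization_iff:
  fixes e :: "'a::comm_ring_1"
  assumes e: "e * e = e"
  shows "SRC_factorization e f f\<^sub>0 f\<^sub>1 \<longleftrightarrow>
    Polynomial.smult e f = f \<and> lead_coeff f = e \<and> Polynomial.smult e f\<^sub>0 = f\<^sub>0 \<and> lead_coeff f\<^sub>0 = e \<and>
    Polynomial.smult e f\<^sub>1 = f\<^sub>1 \<and> lead_coeff f\<^sub>1 = e \<and> f = f\<^sub>0 * f\<^sub>1 \<and>
    (\<exists>u. e * u = u \<and> poly f\<^sub>0 0 * u = e) \<and> (\<exists>u. e * u = u \<and> poly f\<^sub>1 1 * u = e) \<and>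
    (\<exists>a b. a * f\<^sub>0 + b * f\<^sub>1 = [:e:])"
proof -
  have v: "e * poly f z = poly f z" if "Polynomial.smult e f = f" for f z
    using arg_cong[OF that, of "\<lambda>p. poly p z"] by simp
  have i: "genideal (corner_poly_ring e) {f\<^sub>0, f\<^sub>1} = carrier (corner_poly_ring e) \<longleftrightarrow> (\<exists>a b. a * f\<^sub>0 + b * f\<^sub>1 = [:e:])"
    if "Polynomial.smult e f\<^sub>0 = f\<^sub>0" "Polynomial.smult e f\<^sub>1 = f\<^sub>1"
    using that by (intro corner_ring_comaximal_iff) (simp_all add: e)
  show ?thesis
    unfolding SRC_factorization_def SR_factorization_def corner_monic_iff[OF e] Units_corner_ring_iff[OF e]
    using i v poly_at_corner_identity[OF e] by metis
qed

text \<open>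
  A polynomial with leading coefficient \<open>e\<close> behaves towards the multiples of \<open>e\<close> as a monic polynomial
  does towards all polynomials: the product of the leading coefficients is that of the second factor.
\<close>

lemma corner_monic_cancel:
  fixes e :: "'a::comm_ring_1"
  assumes "lead_coeff f = e" and "Polynomial.smult e g = g" and "f * g = 0"
  shows "g = 0"
proof -
  have "e * lead_coeff g = 0"
    using coeff_mult_degree_sum[of f g] assms by simp
  moreover have "e * lead_coeff g = lead_coeff g"
    using arg_cong[OF assms(2), of "\<lambda>p. coeff p (degree g)"] by simp
  ultimately show ?thesis by simp
qed

lemma corner_monic_cofactor:
  fixes e :: "'a::comm_ring_1"
  assumes f: "lead_coeff f = e" and g: "Polynomial.smult e g = g" and fg: "lead_coeff (f * g) = e"
  shows "lead_coeff g = e"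
proof (cases "g = 0")
  case True
  then show ?thesis using fg by simp
next
  case False
  have "e * lead_coeff g = lead_coeff g"
    using arg_cong[OF g, of "\<lambda>p. coeff p (degree g)"] by simp
  then have c: "coeff (f * g) (degree f + degree g) = lead_coeff g"
    using coeff_mult_degree_sum[of f g] f by simp
  with False have "degree (f * g) = degree f + degree g"
    by (intro antisym degree_mult_le le_degree) simp
  with c fg show ?thesis by simp
qed

lemma lead_coeff_smult_eq:
  fixes e :: "'a::comm_ring_1"
  assumes "\<And>j. j \<ge> i \<Longrightarrow> e * coeff p j = (if j = i then e else 0)"
  shows "lead_coeff (Polynomial.smult e p) = e"
proof (cases "e = 0")
  case False
  have "degree (Polynomial.smult e p) = i"
    using assms False by (intro antisym degree_le le_degree) auto
  then show ?thesis using assms[of i] by simp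
qed simp

section \<open>Gluing the local factorizations\<close>

text \<open>
  A family of elements of the corner rings \<open>d\<^sub>i R\<close> is glued to one element by summation; for
  orthogonal \<open>d\<^sub>i\<close> this is compatible with multiplication, all mixed products being zero.
\<close>

lemma orthogonal_sum_mult:
  fixes d :: "'i \<Rightarrow> 'b::comm_ring_1"
  assumes fin: "finite I" and orth: "\<And>i j. i \<in> I \<Longrightarrow> j \<in> I \<Longrightarrow> i \<noteq> j \<Longrightarrow> d i * d j = 0"
    and x: "\<And>i. i \<in> I \<Longrightarrow> d i * x i = x i" and y: "\<And>i. i \<in> I \<Longrightarrow> d i * y i = y i"
  shows "(\<Sum>i\<in>I. x i) * (\<Sum>i\<in>I. y i) = (\<Sum>i\<in>I. x i * y i)"
proof -
  have xy: "x i * y j = 0" if "i \<in> I" "j \<in> I" "i \<noteq> j" for i j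
  proof -
    have "x i * y j = (d i * d j) * (x i * y j)"
      using x[OF that(1)] y[OF that(2)] by (metis mult.assoc mult.left_commute)
    then show ?thesis using orth[OF that] by simp
  qed
  have "(\<Sum>i\<in>I. x i) * (\<Sum>i\<in>I. y i) = (\<Sum>i\<in>I. \<Sum>j\<in>I. if i = j then x i * y i else 0)"
    unfolding sum_product by (intro sum.cong) (auto simp: xy)
  then show ?thesis using fin by simp
qed

text \<open>
  Gluing loses monicity, since the degrees of the factors may depend on the idempotent, but keeps the
  product, the units and the comaximality.
\<close>

lemma clean_variable_mod_if_gSRC:
  fixes h :: "'a::comm_ring_1 poly"
  assumes "has_gSRC_factorization h"
  shows "clean_variable_mod h"
proof -
  obtain I where I: "complete_orthogonal_idempotents I"
    and "\<forall>e\<in>I. \<exists>f\<^sub>0 f\<^sub>1. SRC_factorization e (Polynomial.smult e h) f\<^sub>0 f\<^sub>1"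
    using assms unfolding has_gSRC_factorization_def by blast
  then obtain f\<^sub>0 f\<^sub>1 where F: "\<And>e. e \<in> I \<Longrightarrow> SRC_factorization e (Polynomial.smult e h) (f\<^sub>0 e) (f\<^sub>1 e)"
    by metis
  from I have fin: "finite I" and idem: "\<And>e. e \<in> I \<Longrightarrow> e * e = e"
    and orth: "\<And>e e'. e \<in> I \<Longrightarrow> e' \<in> I \<Longrightarrow> e \<noteq> e' \<Longrightarrow> e * e' = 0" and sum1: "(\<Sum>e\<in>I. e) = 1"
    unfolding complete_orthogonal_idempotents_def by auto
  note F' = iffD1[OF SRC_factorization_iff[OF idem] F]
  have e0: "[:e:] * f\<^sub>0 e = f\<^sub>0 e" and e1: "[:e:] * f\<^sub>1 e = f\<^sub>1 e" and h: "f\<^sub>0 e * f\<^sub>1 e = [:e:] * h" if "e \<in> I" for e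
    using F'[OF that that] by simp_all
  have "\<forall>e\<in>I. \<exists>u. e * u = u \<and> poly (f\<^sub>0 e) 0 * u = e" using F' by blast
  then obtain u where u: "\<And>e. e \<in> I \<Longrightarrow> e * u e = u e \<and> poly (f\<^sub>0 e) 0 * u e = e" by metis
  have "\<forall>e\<in>I. \<exists>w. e * w = w \<and> poly (f\<^sub>1 e) 1 * w = e" using F' by blast
  then obtain w where w: "\<And>e. e \<in> I \<Longrightarrow> e * w e = w e \<and> poly (f\<^sub>1 e) 1 * w e = e" by metis
  have "\<forall>e\<in>I. \<exists>a b. a * f\<^sub>0 e + b * f\<^sub>1 e = [:e:]" using F' by blast
  then obtain a b where ab: "\<And>e. e \<in> I \<Longrightarrow> a e * f\<^sub>0 e + b e * f\<^sub>1 e = [:e:]" by metis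
  have const_orth: "[:e:] * [:e':] = 0" if "e \<in> I" "e' \<in> I" "e \<noteq> e'" for e e' using orth[OF that] by (simp add: mult.commute)
  have const_idem: "[:e:] * [:e:] = [:e:]" if "e \<in> I" for e using idem[OF that] by simp
  have const_sum: "(\<Sum>e\<in>I. [:e:]) = 1"
  proof -
    have "(\<Sum>e\<in>I. [:e:]) = [:\<Sum>e\<in>I. e:]"
      using fin by (induction I rule: finite_induct) auto
    then show ?thesis by (simp add: sum1 one_pCons)
  qed
  define F\<^sub>0 F\<^sub>1 where "F\<^sub>0 = (\<Sum>e\<in>I. f\<^sub>0 e)" and "F\<^sub>1 = (\<Sum>e\<in>I. f\<^sub>1 e)"
  have glue: "(\<Sum>e\<in>I. x e) * (\<Sum>e\<in>I. y e) = (\<Sum>e\<in>I. x e * y e)"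
    if "\<And>e. e \<in> I \<Longrightarrow> [:e:] * x e = x e" "\<And>e. e \<in> I \<Longrightarrow> [:e:] * y e = y e" for x y
    by (rule orthogonal_sum_mult[OF fin const_orth that])
  have "F\<^sub>0 * F\<^sub>1 = (\<Sum>e\<in>I. f\<^sub>0 e * f\<^sub>1 e)"
    unfolding F\<^sub>0_def F\<^sub>1_def by (rule glue) (simp_all only: e0 e1)
  also have "\<dots> = (\<Sum>e\<in>I. [:e:]) * h"
    by (simp only: sum_distrib_right h cong: sum.cong)
  finally have "F\<^sub>0 * F\<^sub>1 = (\<Sum>e\<in>I. [:e:]) * h" .
  then have hF: "h = F\<^sub>0 * F\<^sub>1" by (simp add: const_sum)
  have A0: "(\<Sum>e\<in>I. [:e:] * a e) * F\<^sub>0 = (\<Sum>e\<in>I. [:e:] * a e * f\<^sub>0 e)"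
    unfolding F\<^sub>0_def by (rule glue) (simp_all only: e0 mult.assoc[symmetric] const_idem)
  have B1: "(\<Sum>e\<in>I. [:e:] * b e) * F\<^sub>1 = (\<Sum>e\<in>I. [:e:] * b e * f\<^sub>1 e)"
    unfolding F\<^sub>1_def by (rule glue) (simp_all only: e1 mult.assoc[symmetric] const_idem)
  have "(\<Sum>e\<in>I. [:e:] * a e) * F\<^sub>0 + (\<Sum>e\<in>I. [:e:] * b e) * F\<^sub>1 = (\<Sum>e\<in>I. [:e:] * (a e * f\<^sub>0 e + b e * f\<^sub>1 e))"
    unfolding A0 B1 by (simp only: sum.distrib distrib_left mult.assoc)
  also have "\<dots> = 1"
    using const_sum by (simp only: ab const_idem cong: sum.cong)
  finally have one: "(\<Sum>e\<in>I. [:e:] * a e) * F\<^sub>0 + (\<Sum>e\<in>I. [:e:] * b e) * F\<^sub>1 = 1" .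
  have val: "e * poly f z = poly f z" if "[:e:] * f = f" for e :: 'a and f z
    using arg_cong[OF that, of "\<lambda>p. poly p z"] by simp
  have "poly F\<^sub>0 0 * (\<Sum>e\<in>I. u e) = 1"
    unfolding F\<^sub>0_def poly_sum
    by (subst orthogonal_sum_mult[where d = "\<lambda>e. e", OF fin orth]) (use u val[OF e0] sum1 in \<open>auto cong: sum.cong\<close>)
  moreover have "poly F\<^sub>1 1 * (\<Sum>e\<in>I. w e) = 1"
    unfolding F\<^sub>1_def poly_sum
    by (subst orthogonal_sum_mult[where d = "\<lambda>e. e", OF fin orth]) (use w val[OF e1] sum1 in \<open>auto cong: sum.cong\<close>)
  ultimately show ?thesis
    unfolding hF by (intro clean_variable_mod_if_comaximal[OF one]) (metis dvd_triv_left)+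
qed

section \<open>Determinants of pencils over an idempotent matrix\<close>

text \<open>
  This is \<open>s Q - a B + (1 - Q)\<close>: for an idempotent \<open>Q\<close> and \<open>B = B Q = Q B\<close> it acts as \<open>s - a B\<close> on
  the image of \<open>Q\<close> and as the identity on the complement. Its determinant is thus the determinant
  of \<open>s - a B\<close> on the image of \<open>Q\<close>, defined without choosing a basis there. The second parameter
  makes the pencil homogeneous, which gives the degree of the determinant in \<open>s\<close>.
\<close>

definition pencil :: "'a::comm_ring_1 mat \<Rightarrow> 'a mat \<Rightarrow> 'a \<Rightarrow> 'a \<Rightarrow> 'a mat" where
  "pencil Q B s a = (s - 1) \<cdot>\<^sub>m Q - a \<cdot>\<^sub>m B + 1\<^sub>m (dim_row Q)"

lemma pencil_carrier [simp]:
  "Q \<in> carrier_mat n n \<Longrightarrow> B \<in> carrier_mat n n \<Longrightarrow> pencil Q B s a \<in> carrier_mat n n"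
  by (auto simp: pencil_def)

lemma pencil_index:
  assumes "Q \<in> carrier_mat n n" "B \<in> carrier_mat n n" "i < n" "j < n"
  shows "pencil Q B s a $$ (i, j) = (s - 1) * Q $$ (i, j) - a * B $$ (i, j) + (if i = j then 1 else 0)"
  using assms by (auto simp: pencil_def)

lemma pencil_one_zero: "Q \<in> carrier_mat n n \<Longrightarrow> B \<in> carrier_mat n n \<Longrightarrow> pencil Q B 1 0 = 1\<^sub>m n"
  by (auto simp: pencil_def intro!: eq_matI)

lemma sum_pencil_mult:
  fixes M N :: "nat \<Rightarrow> 'a::comm_ring_1"
  assumes "i < n" "j < n"
  shows "(\<Sum>k<n. (x * M k - a * M' k + (if i = k then 1 else 0)) * (y * N k - b * N' k + (if k = j then 1 else 0)))
    = x * y * (\<Sum>k<n. M k * N k) - x * b * (\<Sum>k<n. M k * N' k) - a * y * (\<Sum>k<n. M' k * N k)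
      + a * b * (\<Sum>k<n. M' k * N' k) + (x * M j - a * M' j) + (y * N i - b * N' i) + (if i = j then 1 else 0)"
proof -
  have "(\<Sum>k<n. (x * M k - a * M' k + (if i = k then 1 else 0)) * (y * N k - b * N' k + (if k = j then 1 else 0)))
    = (\<Sum>k<n. x * y * (M k * N k) - x * b * (M k * N' k) - a * y * (M' k * N k) + a * b * (M' k * N' k)
        + (if k = j then x * M k - a * M' k else 0) + (if i = k then y * N k - b * N' k else 0)
        + (if i = k then if k = j then 1 else 0 else 0))"
    by (rule sum.cong) (auto simp: algebra_simps)
  also have "\<dots> = x * y * (\<Sum>k<n. M k * N k) - x * b * (\<Sum>k<n. M k * N' k) - a * y * (\<Sum>k<n. M' k * N k)
      + a * b * (\<Sum>k<n. M' k * N' k) + (x * M j - a * M' j) + (y * N i - b * N' i) + (if i = j then 1 else 0)"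
    using assms by (simp add: sum.distrib sum_subtractf sum_distrib_left)
  finally show ?thesis .
qed

lemma index_mult_mat_sum:
  "M \<in> carrier_mat n n \<Longrightarrow> N \<in> carrier_mat n n \<Longrightarrow> i < n \<Longrightarrow> j < n \<Longrightarrow>
    (M * N) $$ (i, j) = (\<Sum>k<n. M $$ (i, k) * N $$ (k, j))"
  by (simp add: scalar_prod_def lessThan_atLeast0)

lemma pencil_times_pencil_index:
  fixes Q B Q' B' :: "'a::comm_ring_1 mat"
  assumes Q: "Q \<in> carrier_mat n n" "Q' \<in> carrier_mat n n"
    and B: "B \<in> carrier_mat n n" "B' \<in> carrier_mat n n"
    and ij: "i < n" "j < n"
  shows "(pencil Q B s a * pencil Q' B' r b) $$ (i, j) =
    (s - 1) * (r - 1) * (Q * Q') $$ (i, j) - (s - 1) * b * (Q * B') $$ (i, j)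
    - a * (r - 1) * (B * Q') $$ (i, j) + a * b * (B * B') $$ (i, j)
    + pencil Q B s a $$ (i, j) + pencil Q' B' r b $$ (i, j) - (if i = j then 1 else 0)"
proof -
  have "(pencil Q B s a * pencil Q' B' r b) $$ (i, j) =
      (\<Sum>k<n. pencil Q B s a $$ (i, k) * pencil Q' B' r b $$ (k, j))"
    by (rule index_mult_mat_sum) (use assms in auto)
  also have "\<dots> = (\<Sum>k<n. ((s - 1) * Q $$ (i, k) - a * B $$ (i, k) + (if i = k then 1 else 0))
      * ((r - 1) * Q' $$ (k, j) - b * B' $$ (k, j) + (if k = j then 1 else 0)))"
    by (rule sum.cong) (use assms in \<open>auto simp: pencil_index\<close>)
  finally show ?thesis
    unfolding sum_pencil_mult[OF ij] index_mult_mat_sum[OF Q ij] index_mult_mat_sum[OF Q(1) B(2) ij]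
      index_mult_mat_sum[OF B(1) Q(2) ij] index_mult_mat_sum[OF B ij]
      pencil_index[OF Q(1) B(1) ij] pencil_index[OF Q(2) B(2) ij] by simp
qed

text \<open>
  On the image of \<open>Q\<close> this is \<open>(s - a B) r = s r - a r B\<close>. All facts about the ranks of \<open>Q\<close>
  come from the multiplicativity of the determinant applied to this identity.
\<close>

lemma pencil_mult:
  fixes Q B :: "'a::comm_ring_1 mat"
  assumes Q: "Q \<in> carrier_mat n n" and B: "B \<in> carrier_mat n n"
    and QQ: "Q * Q = Q" and BQ: "B * Q = B"
  shows "pencil Q B s a * pencil Q B r 0 = pencil Q B (s * r) (a * r)"
  using pencil_carrier[OF Q B, of s a] pencil_carrier[OF Q B, of r 0] pencil_carrier[OF Q B, of "s * r" "a * r"]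
  by (intro eq_matI)
     (simp_all add: pencil_times_pencil_index[OF Q Q B B] QQ BQ pencil_index[OF Q B] algebra_simps
        del: index_mult_mat(1))

text \<open>
  Both factors preserve the decomposition by \<open>Q\<close> and \<open>1 - Q\<close>; each is \<open>s - a A\<close> on one
  part and the identity on the other.
\<close>

lemma pencil_mult_complement:
  fixes Q A :: "'a::comm_ring_1 mat"
  assumes Q: "Q \<in> carrier_mat n n" and A: "A \<in> carrier_mat n n"
    and QQ: "Q * Q = Q" and AQ: "A * Q = Q * A"
  shows "pencil Q (A * Q) s a * pencil (1\<^sub>m n - Q) (A * (1\<^sub>m n - Q)) s a = s \<cdot>\<^sub>m 1\<^sub>m n - a \<cdot>\<^sub>m A"
proof -
  let ?Q = "1\<^sub>m n - Q" and ?B = "A * Q"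
  have B: "?B \<in> carrier_mat n n" and A': "A * ?Q \<in> carrier_mat n n" and Q': "?Q \<in> carrier_mat n n"
    using A Q by auto
  have QQ': "Q * ?Q = 0\<^sub>m n n"
    using Q by (subst mult_minus_distrib_mat[of _ n n]) (auto simp: QQ)
  have "Q * (A * ?Q) = A * (Q * ?Q)"
    unfolding assoc_mult_mat[OF Q A Q', symmetric] assoc_mult_mat[OF A Q Q', symmetric] AQ ..
  then have QB': "Q * (A * ?Q) = 0\<^sub>m n n" using QQ' A by simp
  have BQ': "?B * ?Q = 0\<^sub>m n n" using QQ' A Q Q' by (simp add: assoc_mult_mat[of A n n Q n ?Q n])
  have BB': "?B * (A * ?Q) = 0\<^sub>m n n"
    using QB' A Q A' by (simp add: assoc_mult_mat[of A n n Q n "A * ?Q" n])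
  have AQ': "A * ?Q = A - A * Q"
    using A Q by (subst mult_minus_distrib_mat[of _ n n]) auto
  show ?thesis
  proof (rule eq_matI)
    fix i j assume "i < dim_row (s \<cdot>\<^sub>m 1\<^sub>m n - a \<cdot>\<^sub>m A)" "j < dim_col (s \<cdot>\<^sub>m 1\<^sub>m n - a \<cdot>\<^sub>m A)"
    then have ij: "i < n" "j < n" using A by auto
    have *: "(A * ?Q) $$ (i, j) = A $$ (i, j) - (A * Q) $$ (i, j)"
      unfolding AQ' using A Q ij by simp
    show "(pencil Q ?B s a * pencil ?Q (A * ?Q) s a) $$ (i, j) = (s \<cdot>\<^sub>m 1\<^sub>m n - a \<cdot>\<^sub>m A) $$ (i, j)"
      using A Q ij
      by (simp add: pencil_times_pencil_index[OF Q Q' B A'] QQ' QB' BQ' BB' pencil_index[OF Q B] pencil_index[OF Q' A']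
          * algebra_simps del: index_mult_mat(1))
  qed (use pencil_carrier[OF Q B, of s a] pencil_carrier[OF Q' A', of s a] A in auto)
qed

lemma (in comm_ring_hom) pencil_hom:
  assumes "Q \<in> carrier_mat n n" "B \<in> carrier_mat n n"
  shows "map_mat hom (pencil Q B s a) = pencil (map_mat hom Q) (map_mat hom B) (hom s) (hom a)"
  using assms by (intro eq_matI) (auto simp: pencil_def hom_distribs)

abbreviation const_mat :: "'a::comm_ring_1 mat \<Rightarrow> 'a poly mat" where
  "const_mat M \<equiv> map_mat (\<lambda>c. [:c:]) M"

text \<open>
  The matrices are constant and the parameters are polynomials: \<open>(t, 1)\<close> gives a characteristic
  polynomial, \<open>(1, t)\<close> the same polynomial with its coefficients reversed, and \<open>(t, 0)\<close> the rank.
\<close>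

definition pencil_det :: "'a::comm_ring_1 mat \<Rightarrow> 'a mat \<Rightarrow> 'a poly \<Rightarrow> 'a poly \<Rightarrow> 'a poly" where
  "pencil_det Q B s a = det (pencil (const_mat Q) (const_mat B) s a)"

lemma const_hom: "comm_ring_hom (\<lambda>c. [:c::'a::comm_ring_1:])"
  by unfold_locales (auto simp: one_pCons)

lemma (in comm_ring_hom) eval_hom: "comm_ring_hom (\<lambda>p. poly (map_poly hom p) s)"
proof -
  interpret map_poly_hom: map_poly_comm_ring_hom hom ..
  show ?thesis by unfold_locales (auto simp: hom_distribs)
qed

text \<open>
  Substitution into the determinant is used for targets beyond \<open>R\<close> itself: polynomials in two
  variables and Laurent series.
\<close>

lemma (in comm_ring_hom) eval_pencil_det:
  assumes Q: "Q \<in> carrier_mat n n" and B: "B \<in> carrier_mat n n"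
  shows "poly (map_poly hom (pencil_det Q B p q)) s =
    det (pencil (map_mat hom Q) (map_mat hom B) (poly (map_poly hom p) s) (poly (map_poly hom q) s))"
proof -
  interpret ev: comm_ring_hom "\<lambda>p. poly (map_poly hom p) s" by (rule eval_hom)
  have c: "map_mat (\<lambda>p. poly (map_poly hom p) s) (const_mat M) = map_mat hom M" for M
    by (auto simp: map_poly_pCons hom_distribs)
  show ?thesis
    using Q B unfolding pencil_det_def ev.hom_det[symmetric]
    by (subst ev.pencil_hom[of _ n]) (auto simp: c)
qed

lemma poly_pencil_det:
  fixes Q B :: "'a::comm_ring_1 mat"
  assumes Q: "Q \<in> carrier_mat n n" and B: "B \<in> carrier_mat n n"
  shows "poly (pencil_det Q B p q) s = det (pencil Q B (poly p s) (poly q s))"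
proof -
  interpret comm_ring_hom "\<lambda>c. c :: 'a" by unfold_locales auto
  have m: "map_poly (\<lambda>c. c :: 'a) p = p" for p
    by (rule poly_eqI) (simp add: coeff_map_poly)
  have "map_mat (\<lambda>c. c) M = M" for M :: "'a mat" by auto
  then show ?thesis using eval_pencil_det[OF Q B, of p q s] by (simp add: m)
qed

lemma (in comm_ring_hom) det_pencil_map_mult:
  assumes Q: "Q \<in> carrier_mat n n" and B: "B \<in> carrier_mat n n"
    and QQ: "Q * Q = Q" and BQ: "B * Q = B"
  defines "D \<equiv> \<lambda>s a. det (pencil (map_mat hom Q) (map_mat hom B) s a)"
  shows "D s a * D r 0 = D (s * r) (a * r)"
proof -
  have Q': "map_mat hom Q \<in> carrier_mat n n" and B': "map_mat hom B \<in> carrier_mat n n"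
    using Q B by auto
  have "map_mat hom Q * map_mat hom Q = map_mat hom Q" "map_mat hom B * map_mat hom Q = map_mat hom B"
    using mat_hom_mult[OF Q Q] mat_hom_mult[OF B Q] by (simp_all add: QQ BQ)
  from pencil_mult[OF Q' B' this, of s a r] show ?thesis
    unfolding D_def by (metis det_mult pencil_carrier Q' B')
qed

section \<open>Rank idempotents\<close>

text \<open>
  The polynomial \<open>det (t Q + (1 - Q))\<close>. For a diagonal \<open>Q\<close> with \<open>i\<close> ones and otherwise zeros it is
  \<open>t\<^sup>i\<close>; for an arbitrary idempotent \<open>Q\<close> its \<open>i\<close>-th coefficient is the idempotent of \<open>R\<close> that cuts
  out the part where the image of \<open>Q\<close> has rank \<open>i\<close>.
\<close>

definition rank_poly :: "'a::comm_ring_1 mat \<Rightarrow> 'a poly" where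
  "rank_poly Q = pencil_det Q (0\<^sub>m (dim_row Q) (dim_row Q)) [:0, 1:] 0"

lemma pencil_det_0: "Q \<in> carrier_mat n n \<Longrightarrow> B \<in> carrier_mat n n \<Longrightarrow> pencil_det Q B [:0, 1:] 0 = rank_poly Q"
  unfolding rank_poly_def pencil_det_def by (auto intro!: arg_cong[of _ _ det] eq_matI simp: pencil_def)

text \<open>
  The rank polynomial \<open>P\<close> is multiplicative, \<open>P(x) P(y) = P(x y)\<close>. With independent variables \<open>x\<close> and
  \<open>y\<close>, comparing the coefficients of \<open>x\<^sup>i y\<^sup>j\<close> gives orthogonality and idempotence.
\<close>

lemma rank_poly_coeff_mult:
  fixes Q :: "'a::comm_ring_1 mat"
  assumes Q: "Q \<in> carrier_mat n n" and QQ: "Q * Q = Q"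
  shows "coeff (rank_poly Q) i * coeff (rank_poly Q) j = (if i = j then coeff (rank_poly Q) i else 0)"
proof -
  let ?c = "\<lambda>c::'a. [:[:c:]:]" and ?P = "rank_poly Q" and ?O = "0\<^sub>m n n :: 'a mat"
  define x y :: "'a poly poly" where "x = [:[:0, 1:]:]" and "y = [:0, 1:]"
  interpret c: comm_ring_hom ?c by unfold_locales (auto simp: one_pCons)
  have O: "?O \<in> carrier_mat n n" and OQ: "?O * Q = ?O" using Q by auto
  have P: "?P = pencil_det Q ?O [:0, 1:] 0" using pencil_det_0[OF Q O] by simp
  have ev: "poly (map_poly ?c ?P) s = det (pencil (map_mat ?c Q) (map_mat ?c ?O) s 0)" for s
    unfolding P c.eval_pencil_det[OF Q O] by (simp add: map_poly_pCons)
  have prod: "poly (map_poly ?c ?P) x * poly (map_poly ?c ?P) y = poly (map_poly ?c ?P) (x * y)"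
    unfolding ev using c.det_pencil_map_mult[OF Q O QQ OQ, of x 0 y] by simp
  have x: "poly (map_poly ?c p) x = [:p:]" for p :: "'a poly"
    by (induction p) (auto simp: map_poly_pCons x_def)
  have y: "poly (map_poly ?c p) y = map_poly (\<lambda>c. [:c:]) p" for p :: "'a poly"
    by (induction p) (auto simp: map_poly_pCons y_def)
  have xy: "coeff (coeff (poly (map_poly ?c p) (x * y)) j) i = (if i = j then coeff p i else 0)" for p :: "'a poly"
    by (induction p arbitrary: i j) (auto simp: map_poly_pCons x_def y_def coeff_pCons split: nat.splits)
  have "coeff (coeff ([:?P:] * map_poly (\<lambda>c. [:c:]) ?P) j) i = (if i = j then coeff ?P i else 0)"
    using prod unfolding x y by (simp add: xy)
  then show ?thesis by (simp add: coeff_map_poly mult.commute)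
qed

lemma rank_poly_at_1:
  assumes Q: "Q \<in> carrier_mat n n"
  shows "poly (rank_poly Q) 1 = 1"
  using Q unfolding rank_poly_def by (subst poly_pencil_det[of _ n]) (auto simp: pencil_one_zero)

text \<open>
  Passing from the sequence of coefficients to the set does not change the sum: a value that occurs
  at two different indices is the product of the coefficients there, hence zero.
\<close>

lemma complete_orthogonal_rank_idempotents:
  fixes Q :: "'a::comm_ring_1 mat"
  assumes Q: "Q \<in> carrier_mat n n" and QQ: "Q * Q = Q"
  shows "complete_orthogonal_idempotents (coeff (rank_poly Q) ` {..degree (rank_poly Q)})"
proof -
  let ?e = "coeff (rank_poly Q)" and ?N = "{..degree (rank_poly Q)}"
  note e = rank_poly_coeff_mult[OF Q QQ]
  have "(\<Sum>x\<in>?e ` ?N. x) = (\<Sum>i\<in>?N. ?e i)"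
  proof (subst sum.reindex_nontrivial)
    fix i j assume "i \<noteq> j" "?e i = ?e j"
    then show "?e i = 0" using e[of i i] e[of i j] by simp
  qed auto
  also have "\<dots> = 1"
    using rank_poly_at_1[OF Q] by (simp add: poly_altdef)
  finally show ?thesis
    unfolding complete_orthogonal_idempotents_def by (auto simp: e)
qed

lemma fls_eval_X:
  "fls_nth (poly (map_poly fls_const p) fls_X) m = (if m \<ge> 0 then coeff p (nat m) else (0::'a::comm_ring_1))"
proof (induction p arbitrary: m)
  case (pCons a p)
  have "fls_nth (poly (map_poly fls_const (pCons a p)) fls_X) m =
      (if m = 0 then a else 0) + (if m \<ge> 1 then coeff p (nat (m - 1)) else 0)"
    unfolding map_poly_pCons[OF pCons.hyps(1)] by (simp add: fls_X_times_conv_shift pCons.IH)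
  moreover have "nat m = Suc (nat (m - 1))" if "m \<ge> 1" using that by simp
  ultimately show ?case by (cases "m \<ge> 1") auto
qed simp

lemma fls_eval_X_inv:
  "fls_nth (poly (map_poly fls_const p) fls_X_inv) m = (if m \<le> 0 then coeff p (nat (- m)) else (0::'a::comm_ring_1))"
proof (induction p arbitrary: m)
  case (pCons a p)
  have "fls_nth (poly (map_poly fls_const (pCons a p)) fls_X_inv) m =
      (if m = 0 then a else 0) + (if m \<le> - 1 then coeff p (nat (- (m + 1))) else 0)"
    unfolding map_poly_pCons[OF pCons.hyps(1)] by (simp add: fls_X_inv_times_conv_shift pCons.IH)
  moreover have "nat (- m) = Suc (nat (- (m + 1)))" if "m \<le> - 1" using that by simp
  ultimately show ?case by (cases "m \<le> - 1") auto
qed simp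

text \<open>
  Where \<open>Q\<close> has rank \<open>i\<close>, the determinant \<open>F(t)\<close> of \<open>t - B\<close> on the image of \<open>Q\<close> is monic of degree
  \<open>i\<close>. To see this, let \<open>K(x)\<close> be the determinant of \<open>1 - x B\<close> there. As \<open>x (1/x - B) = 1 - x B\<close>,
  multiplicativity gives \<open>F(1/x) P(x) = K(x)\<close> for Laurent series in \<open>x\<close>, where \<open>P\<close> is the rank
  polynomial. Multiplied by the \<open>i\<close>-th rank idempotent \<open>e\<close> this reads
  \<open>e x\<^sup>i F(1/x) = e K(x)\<close>. The right-hand side has no negative powers and its constant term is \<open>e\<close>, as
  \<open>K(0) = 1\<close>; on the left the coefficient of \<open>x\<close> to the power \<open>i - j\<close> is \<open>e\<close> times the \<open>j\<close>-th
  coefficient of \<open>F\<close>.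
\<close>

lemma coeff_rank_component:
  fixes Q B :: "'a::comm_ring_1 mat"
  assumes Q: "Q \<in> carrier_mat n n" and B: "B \<in> carrier_mat n n"
    and QQ: "Q * Q = Q" and BQ: "B * Q = B" and j: "j \<ge> i"
  shows "coeff (rank_poly Q) i * coeff (pencil_det Q B [:0, 1:] 1) j =
    (if j = i then coeff (rank_poly Q) i else 0)"
proof -
  define e where "e = coeff (rank_poly Q) i"
  define F where "F = pencil_det Q B [:0, 1:] 1"
  define K where "K = pencil_det Q B 1 [:0, 1:]"
  interpret c: comm_ring_hom "fls_const :: 'a \<Rightarrow> 'a fls"
    by unfold_locales (auto simp: fls_plus_const)
  let ?ev = "\<lambda>p s. poly (map_poly fls_const p) s"
  have "?ev F fls_X_inv * ?ev (rank_poly Q) fls_X = ?ev K fls_X"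
    unfolding F_def K_def pencil_det_0[OF Q B, symmetric] c.eval_pencil_det[OF Q B]
    using c.det_pencil_map_mult[OF Q B QQ BQ, of fls_X_inv 1 fls_X]
    by (simp add: map_poly_pCons fls_X_inv_times_conv_shift)
  then have "fls_const e * (?ev F fls_X_inv * ?ev (rank_poly Q) fls_X) = fls_const e * ?ev K fls_X"
    by simp
  moreover have "fls_const e * ?ev (rank_poly Q) fls_X = fls_const e * fls_X ^ i"
    unfolding e_def
    by (rule fls_eqI) (auto simp: fls_eval_X rank_poly_coeff_mult[OF Q QQ] fls_X_power_nth)
  ultimately have "fls_const e * fls_X ^ i * ?ev F fls_X_inv = fls_const e * ?ev K fls_X"
    by (metis mult.assoc mult.commute)
  then have "fls_const e * (fls_X ^ i * ?ev F fls_X_inv) = fls_const e * ?ev K fls_X"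
    by (simp only: mult.assoc)
  then have "fls_nth (fls_const e * (fls_X ^ i * ?ev F fls_X_inv)) (int i - int j) =
      fls_nth (fls_const e * ?ev K fls_X) (int i - int j)"
    by simp
  then have "e * coeff F j = (if j = i then e * coeff K 0 else 0)"
    using j by (simp add: fls_X_power_times_conv_shift fls_eval_X fls_eval_X_inv)
  moreover have "coeff K 0 = 1"
    unfolding K_def poly_0_coeff_0[symmetric] poly_pencil_det[OF Q B] by (simp add: pencil_one_zero[OF Q B])
  ultimately show ?thesis by (simp add: e_def F_def)
qed

section \<open>The companion matrix\<close>

lemma companion_mat_carrier: "companion_mat h \<in> carrier_mat (degree h) (degree h)"
  by (simp add: companion_mat_def)

text \<open>
  The companion matrix describes multiplication by \<open>t\<close> on \<open>R[t]/(h)\<close> in the basis of powers of \<open>t\<close>.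
  So the row of these powers is annihilated by \<open>t - C\<^sub>h\<close> up to multiples of \<open>h\<close>, and the only
  nonzero multiple, \<open>h\<close> itself, arises in the last column from the reduction of \<open>t\<^sup>n\<close>.
\<close>

lemma monomial_row_times_companion:
  fixes h :: "'a::comm_ring_1 poly"
  assumes n: "degree h = n" and m: "monic h" and k: "k < n"
  shows "(\<Sum>i<n. monom 1 i * char_poly_matrix (companion_mat h) $$ (i, k)) = (if k = n - 1 then h else 0)"
proof -
  have X: "char_poly_matrix (companion_mat h) $$ (i, k) =
      (if i = k then [:0, 1:] else 0) - [:if k = n - 1 then - coeff h i else if i = k + 1 then 1 else 0:]"
    if "i < n" for i
    using that k n by (auto simp: char_poly_matrix_def companion_mat_def)
  have "(\<Sum>i<n. monom 1 i * char_poly_matrix (companion_mat h) $$ (i, k)) =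
      (\<Sum>i<n. (if i = k then monom 1 (Suc k) else 0) -
        (if k = n - 1 then - monom (coeff h i) i else if i = k + 1 then monom 1 (Suc k) else 0))"
    by (intro sum.cong) (auto simp: X algebra_simps monom_Suc smult_monom minus_monom)
  also have "\<dots> = monom 1 (Suc k) -
      (\<Sum>i<n. if k = n - 1 then - monom (coeff h i) i else if i = k + 1 then monom 1 (Suc k) else 0)"
    unfolding sum_subtractf using k by simp
  also have "\<dots> = (if k = n - 1 then h else 0)"
  proof (cases "k = n - 1")
    case True
    then have "n = Suc k" using k by simp
    then have "h = monom 1 (Suc k) + (\<Sum>i<n. monom (coeff h i) i)"
      using poly_as_sum_of_monoms[of h] m n by (simp add: lessThan_Suc_atMost[symmetric] algebra_simps)
    then show ?thesis using True by (simp add: sum_negf)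
  next
    case False
    then show ?thesis using k by simp
  qed
  finally show ?thesis .
qed

lemma dvd_monomial_row_times:
  fixes h :: "'a::comm_ring_1 poly"
  assumes n: "degree h = n" and m: "monic h" and Y: "Y \<in> carrier_mat n n" and k: "k < n"
  shows "h dvd (\<Sum>i<n. monom 1 i * (char_poly_matrix (companion_mat h) * Y) $$ (i, k))"
proof -
  let ?X = "char_poly_matrix (companion_mat h)"
  have X: "?X \<in> carrier_mat n n" using companion_mat_carrier[of h] n by simp
  have "(\<Sum>i<n. monom 1 i * (?X * Y) $$ (i, k)) = (\<Sum>i<n. \<Sum>l<n. monom 1 i * ?X $$ (i, l) * Y $$ (l, k))"
    by (intro sum.cong refl) (simp add: index_mult_mat_sum[OF X Y] k sum_distrib_left mult.assoc del: index_mult_mat(1))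
  also have "\<dots> = (\<Sum>l<n. (\<Sum>i<n. monom 1 i * ?X $$ (i, l)) * Y $$ (l, k))"
    by (subst sum.swap) (simp add: sum_distrib_right)
  also have "\<dots> = (\<Sum>l<n. (if l = n - 1 then h else 0) * Y $$ (l, k))"
    by (intro sum.cong) (auto simp: monomial_row_times_companion[OF n m])
  finally show ?thesis by (auto intro: dvd_sum)
qed

text \<open>
  The product of \<open>t - C\<^sub>h\<close> with its adjugate is the scalar matrix \<open>\<chi>\<close>, so the preceding lemma shows
  that \<open>h\<close> divides \<open>\<chi>\<close>. Both are monic of the same degree.
\<close>

lemma char_poly_companion_mat:
  fixes h :: "'a::comm_ring_1 poly"
  assumes n: "degree h = n" "n > 0" and m: "monic h"
  shows "char_poly (companion_mat h) = h"
proof -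
  let ?C = "companion_mat h" and ?\<chi> = "char_poly (companion_mat h)"
  have C: "?C \<in> carrier_mat n n" using companion_mat_carrier[of h] n by simp
  then have X: "char_poly_matrix ?C \<in> carrier_mat n n" by simp
  have "(\<Sum>i<n. monom 1 i * (char_poly_matrix ?C * adj_mat (char_poly_matrix ?C)) $$ (i, 0)) =
      (\<Sum>i<n. if i = 0 then ?\<chi> else 0)"
    using n by (intro sum.cong) (auto simp: adj_mat(2)[OF X] char_poly_def monom_0 simp del: index_mult_mat(1))
  then have "h dvd ?\<chi>"
    using dvd_monomial_row_times[OF n(1) m adj_mat(1)[OF X] n(2)] n by simp
  then obtain q where q: "?\<chi> = h * q" ..
  have d: "degree ?\<chi> = n" "lead_coeff ?\<chi> = 1" using degree_monic_char_poly[OF C] by auto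
  have q1: "lead_coeff q = 1"
    using corner_monic_cofactor[of h 1 q] m d(2) by (simp add: q)
  then have "degree (h * q) = n + degree q"
    using coeff_mult_degree_sum[of h q] m n by (intro antisym le_degree) (auto simp: degree_mult_le)
  then have "degree q = 0" using d(1) q by simp
  then have "q = 1" using q1 by (metis degree_eq_zeroE coeff_pCons_0 one_pCons lead_coeff_pCons(2))
  then show ?thesis using q by simp
qed

section \<open>Characteristic polynomials on the image of a commuting idempotent\<close>

lemma const_mat_one_minus: "Q \<in> carrier_mat n n \<Longrightarrow> const_mat (1\<^sub>m n - Q) = 1\<^sub>m n - const_mat (Q::'a::comm_ring_1 mat)"
  by (auto intro!: eq_matI simp: one_pCons)

lemma const_mat_mult:
  "M \<in> carrier_mat n n \<Longrightarrow> N \<in> carrier_mat n n \<Longrightarrow> const_mat (M * N) = const_mat M * const_mat (N::'a::comm_ring_1 mat)"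
proof -
  interpret comm_ring_hom "\<lambda>c::'a. [:c:]" by (rule const_hom)
  show "M \<in> carrier_mat n n \<Longrightarrow> N \<in> carrier_mat n n \<Longrightarrow> const_mat (M * N) = const_mat M * const_mat N"
    by (rule mat_hom_mult)
qed

lemma char_poly_matrix_alt:
  "A \<in> carrier_mat n n \<Longrightarrow> char_poly_matrix A = [:0, 1:] \<cdot>\<^sub>m 1\<^sub>m n - 1 \<cdot>\<^sub>m const_mat A"
  by (auto intro!: eq_matI simp: char_poly_matrix_def)

lemma idempotent_complement:
  fixes Q :: "'a::comm_ring_1 mat"
  assumes Q: "Q \<in> carrier_mat n n" and QQ: "Q * Q = Q"
  shows "(1\<^sub>m n - Q) * (1\<^sub>m n - Q) = 1\<^sub>m n - Q"
proof -
  have "(1\<^sub>m n - Q) * (1\<^sub>m n - Q) = (1\<^sub>m n - Q) - (Q - Q)"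
    using Q by (subst mult_minus_distrib_mat[of _ n n]) (auto simp: minus_mult_distrib_mat[of _ n n] QQ)
  then show ?thesis using Q by auto
qed

context
  fixes A Q :: "'a::comm_ring_1 mat" and n :: nat
  assumes A: "A \<in> carrier_mat n n" and Q: "Q \<in> carrier_mat n n"
    and QQ: "Q * Q = Q" and AQ: "A * Q = Q * A"
begin

lemma pencil_det_mult_complement:
  "pencil_det Q (A * Q) [:0, 1:] 1 * pencil_det (1\<^sub>m n - Q) (A * (1\<^sub>m n - Q)) [:0, 1:] 1 = char_poly A"
proof -
  let ?A = "const_mat A" and ?Q = "const_mat Q"
  have Q': "1\<^sub>m n - Q \<in> carrier_mat n n" using Q by auto
  have cA: "?A \<in> carrier_mat n n" and cQ: "?Q \<in> carrier_mat n n" using A Q by auto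
  have c: "?Q * ?Q = ?Q" "?A * ?Q = ?Q * ?A"
    using const_mat_mult[OF Q Q] const_mat_mult[OF A Q] const_mat_mult[OF Q A] by (simp_all add: QQ AQ)
  have cQ': "1\<^sub>m n - ?Q \<in> carrier_mat n n" using cQ by auto
  show ?thesis
    unfolding pencil_det_def const_mat_mult[OF A Q] const_mat_mult[OF A Q'] const_mat_one_minus[OF Q]
    using pencil_carrier[OF cQ mult_carrier_mat[OF cA cQ]] pencil_carrier[OF cQ' mult_carrier_mat[OF cA cQ']]
    by (subst det_mult[of _ n, symmetric])
       (auto simp: pencil_mult_complement[OF cQ cA c] char_poly_def char_poly_matrix_alt[OF A])
qed

lemma idempotent_times_pencil:
  "Q * pencil Q (A * Q) s a = (s \<cdot>\<^sub>m 1\<^sub>m n - a \<cdot>\<^sub>m A) * Q"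
proof -
  have B: "A * Q \<in> carrier_mat n n" using A Q by simp
  have QB: "Q * (A * Q) = A * Q"
    using A Q by (metis AQ QQ assoc_mult_mat)
  have "Q * pencil Q (A * Q) s a = Q * ((s - 1) \<cdot>\<^sub>m Q - a \<cdot>\<^sub>m (A * Q)) + Q * 1\<^sub>m n"
    unfolding pencil_def using A Q by (subst mult_add_distrib_mat[of _ n n _ n]) auto
  also have "Q * ((s - 1) \<cdot>\<^sub>m Q - a \<cdot>\<^sub>m (A * Q)) = (s - 1) \<cdot>\<^sub>m (Q * Q) - a \<cdot>\<^sub>m (Q * (A * Q))"
    using A Q by (simp add: mult_minus_distrib_mat[of _ n n _ n] mult_smult_distrib[of _ n n _ n])
  also have "\<dots> = (s - 1) \<cdot>\<^sub>m Q - a \<cdot>\<^sub>m (A * Q)" unfolding QQ QB ..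
  also have "\<dots> + Q * 1\<^sub>m n = s \<cdot>\<^sub>m Q - a \<cdot>\<^sub>m (A * Q)"
    using A Q by (auto intro!: eq_matI simp: algebra_simps simp del: index_mult_mat(1))
  also have "\<dots> = (s \<cdot>\<^sub>m 1\<^sub>m n) * Q - (a \<cdot>\<^sub>m A) * Q"
    using A Q by (simp add: mult_smult_assoc_mat[of _ n n _ n])
  also have "\<dots> = (s \<cdot>\<^sub>m 1\<^sub>m n - a \<cdot>\<^sub>m A) * Q"
    using A Q by (subst minus_mult_distrib_mat[of _ n n _ _ n]) auto
  finally show ?thesis .
qed

end

text \<open>
  A Cayley-Hamilton relation on the image of \<open>Q\<close>, stated as divisibility by \<open>t - A\<close>. On this
  image the pencil \<open>T\<close> is \<open>t - A\<close>, so \<open>Q T = (t - A) Q\<close>; multiply by the adjugate of \<open>T\<close>.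
\<close>

lemma pencil_det_times_idempotent:
  fixes A Q :: "'a::comm_ring_1 mat"
  assumes A: "A \<in> carrier_mat n n" and Q: "Q \<in> carrier_mat n n"
    and QQ: "Q * Q = Q" and AQ: "A * Q = Q * A"
  obtains Y where "Y \<in> carrier_mat n n"
    and "pencil_det Q (A * Q) [:0, 1:] 1 \<cdot>\<^sub>m const_mat Q = char_poly_matrix A * Y"
proof -
  let ?A = "const_mat A" and ?Q = "const_mat Q"
  let ?T = "pencil ?Q (?A * ?Q) [:0, 1:] 1"
  have cA: "?A \<in> carrier_mat n n" and cQ: "?Q \<in> carrier_mat n n" using A Q by auto
  have c: "?Q * ?Q = ?Q" "?A * ?Q = ?Q * ?A"
    using const_mat_mult[OF Q Q] const_mat_mult[OF A Q] const_mat_mult[OF Q A] by (simp_all add: QQ AQ)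
  have T: "?T \<in> carrier_mat n n" and X: "char_poly_matrix A \<in> carrier_mat n n" using cA cQ A by auto
  note adj = adj_mat[OF T]
  have "pencil_det Q (A * Q) [:0, 1:] 1 \<cdot>\<^sub>m ?Q = ?Q * (det ?T \<cdot>\<^sub>m 1\<^sub>m n)"
    unfolding pencil_det_def const_mat_mult[OF A Q] using cQ by (simp add: mult_smult_distrib[of _ n n _ n])
  also have "\<dots> = (?Q * ?T) * adj_mat ?T"
    unfolding adj(2)[symmetric] by (rule assoc_mult_mat[OF cQ T adj(1), symmetric])
  also have "\<dots> = (char_poly_matrix A * ?Q) * adj_mat ?T"
    unfolding idempotent_times_pencil[OF cA cQ c] char_poly_matrix_alt[OF A] ..
  also have "\<dots> = char_poly_matrix A * (?Q * adj_mat ?T)"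
    by (rule assoc_mult_mat[OF X cQ adj(1)])
  finally show ?thesis using cQ adj(1) by (intro that[of "?Q * adj_mat ?T"]) auto
qed

text \<open>
  Under the identification of \<open>R\<^sup>n\<close> with \<open>R[t]/(h)\<close> that turns \<open>C\<^sub>h\<close> into multiplication by \<open>t\<close>, this
  represents the image of \<open>1\<close>. A matrix that commutes with \<open>C\<^sub>h\<close> is multiplication by it.
\<close>

definition first_col_poly :: "nat \<Rightarrow> 'a::comm_ring_1 mat \<Rightarrow> 'a poly" where
  "first_col_poly n M = (\<Sum>i<n. monom (M $$ (i, 0)) i)"

text \<open>
  The characteristic polynomial of \<open>t\<close> on a direct summand of \<open>R[t]/(h)\<close> annihilates that summand,
  in particular the component of \<open>1\<close> in it.
\<close>

lemma companion_dvd_pencil_det: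
  fixes h :: "'a::comm_ring_1 poly"
  assumes n: "degree h = n" "n > 0" and m: "monic h"
    and Q: "Q \<in> carrier_mat n n" and QQ: "Q * Q = Q" and CQ: "companion_mat h * Q = Q * companion_mat h"
  shows "h dvd pencil_det Q (companion_mat h * Q) [:0, 1:] 1 * first_col_poly n Q"
proof -
  let ?C = "companion_mat h"
  let ?F = "pencil_det Q (companion_mat h * Q) [:0, 1:] 1"
  have C: "?C \<in> carrier_mat n n" using companion_mat_carrier[of h] n by simp
  obtain Y where Y: "Y \<in> carrier_mat n n" and FY: "?F \<cdot>\<^sub>m const_mat Q = char_poly_matrix ?C * Y"
    by (rule pencil_det_times_idempotent[OF C Q QQ CQ])
  have "?F * first_col_poly n Q = (\<Sum>i<n. monom 1 i * (?F \<cdot>\<^sub>m const_mat Q) $$ (i, 0))"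
    unfolding first_col_poly_def sum_distrib_left
  proof (rule sum.cong)
    fix i assume "i \<in> {..<n}"
    then have "monom 1 i * (?F \<cdot>\<^sub>m const_mat Q) $$ (i, 0) = monom 1 i * (?F * [:Q $$ (i, 0):])"
      using Q n by simp
    also have "\<dots> = ?F * (monom 1 i * [:Q $$ (i, 0):])"
      by (simp only: mult.left_commute)
    also have "monom 1 i * [:Q $$ (i, 0):] = monom (Q $$ (i, 0)) i"
      by (simp add: smult_monom)
    finally show "?F * monom (Q $$ (i, 0)) i = monom 1 i * (?F \<cdot>\<^sub>m const_mat Q) $$ (i, 0)" ..
  qed simp
  also have "h dvd \<dots>" unfolding FY by (rule dvd_monomial_row_times[OF n(1) m Y n(2)])
  finally show ?thesis .
qed

text \<open>
  This is the determinant of \<open>-U\<close> on the image of \<open>Q\<close>; times the one on the complement it is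
  the unit \<open>det (-U)\<close>.
\<close>

lemma pencil_det_unit:
  fixes U Q :: "'a::comm_ring_1 mat"
  assumes U: "U \<in> carrier_mat n n" and V: "V \<in> carrier_mat n n" and UV: "U * V = 1\<^sub>m n"
    and Q: "Q \<in> carrier_mat n n" and QQ: "Q * Q = Q" and UQ: "U * Q = Q * U"
  shows "det (pencil Q (U * Q) 0 1) dvd 1"
proof -
  let ?Q = "1\<^sub>m n - Q"
  have Q': "?Q \<in> carrier_mat n n" using Q by auto
  have "det (pencil Q (U * Q) 0 1) * det (pencil ?Q (U * ?Q) 0 1) = det (- U)"
  proof -
    have "0 \<cdot>\<^sub>m 1\<^sub>m n - 1 \<cdot>\<^sub>m U = - U" using U by auto
    then show ?thesis
      using U Q pencil_carrier[OF Q mult_carrier_mat[OF U Q]] pencil_carrier[OF Q' mult_carrier_mat[OF U Q']]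
      by (subst det_mult[of _ n, symmetric]) (auto simp: pencil_mult_complement[OF Q U QQ UQ])
  qed
  moreover have "det (- U) * det (- V) = 1"
    using U V by (subst det_mult[of _ n, symmetric]) (auto simp: UV)
  ultimately have "det (pencil Q (U * Q) 0 1) * (det (pencil ?Q (U * ?Q) 0 1) * det (- V)) = 1"
    by (simp add: mult.assoc[symmetric])
  then show ?thesis by (metis dvd_triv_left)
qed

section \<open>From the companion matrix to a factorization\<close>

text \<open>
  On the image of \<open>Q = 1 - E\<close> the matrix \<open>C\<close> itself is invertible and on the image of \<open>E\<close> the matrix
  \<open>C - 1\<close>, so that the characteristic polynomials there are the factors \<open>f\<^sub>0\<close> and \<open>f\<^sub>1\<close>. The set
  of idempotents consists of the rank idempotents of \<open>Q\<close>.
\<close>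

lemma gSRC_if_companion_strongly_clean:
  fixes h :: "'a::comm_ring_1 poly"
  assumes n: "degree h = n" "n > 0" and m: "monic h"
    and sc: "strongly_clean_in (ring_mat TYPE('a) n ()) (companion_mat h)"
  shows "has_gSRC_factorization h"
proof -
  let ?C = "companion_mat h"
  have C: "?C \<in> carrier_mat n n" using companion_mat_carrier[of h] n by simp
  from sc obtain E U V where E: "E \<in> carrier_mat n n" and EE: "E * E = E"
    and U: "U \<in> carrier_mat n n" and V: "V \<in> carrier_mat n n" and UV: "U * V = 1\<^sub>m n"
    and CEU: "?C = E + U" and EU: "E * U = U * E"
    unfolding strongly_clean_in_def idempotent_in_def Units_def by (auto simp: ring_mat_simps)
  define Q where "Q = 1\<^sub>m n - E"
  have Q: "Q \<in> carrier_mat n n" and QQ: "Q * Q = Q"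
    using E idempotent_complement[OF E EE] by (auto simp: Q_def)
  have QE: "1\<^sub>m n - Q = E" using E by (auto simp: Q_def)
  have UQ: "U * Q = Q * U" unfolding Q_def using U E
    by (simp add: mult_minus_distrib_mat[of _ n n _ n] minus_mult_distrib_mat[of _ n n _ _ n] EU)
  have CE: "?C * E = E + U * E" unfolding CEU using E U EE by (simp add: add_mult_distrib_mat[of _ n n _ _ n])
  have CEc: "?C * E = E * ?C" unfolding CE unfolding CEU using E U EE EU by (simp add: mult_add_distrib_mat[of _ n n _ n])
  have CQc: "?C * Q = Q * ?C" unfolding Q_def using C E
    by (simp add: mult_minus_distrib_mat[of _ n n _ n] minus_mult_distrib_mat[of _ n n _ _ n] CEc)
  have EQ0: "E * Q = 0\<^sub>m n n" unfolding Q_def using E EE by (auto simp: mult_minus_distrib_mat[of _ n n _ n])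
  have CQ: "?C * Q = U * Q" unfolding CEU using E U Q EQ0 by (simp add: add_mult_distrib_mat[of _ n n _ _ n])
  have BQ: "?C * Q * Q = ?C * Q" using C Q QQ by (simp add: assoc_mult_mat[of _ n n _ n _ n])
  have CQcar: "?C * Q \<in> carrier_mat n n" and CEcar: "?C * E \<in> carrier_mat n n" using C E Q by auto
  define F\<^sub>0 where "F\<^sub>0 = pencil_det Q (?C * Q) [:0, 1:] 1"
  define F\<^sub>1 where "F\<^sub>1 = pencil_det E (?C * E) [:0, 1:] 1"
  have hF: "h = F\<^sub>0 * F\<^sub>1"
    using pencil_det_mult_complement[OF C Q QQ CQc] char_poly_companion_mat[OF n m]
    by (simp add: F\<^sub>0_def F\<^sub>1_def QE)
  have "poly F\<^sub>0 0 dvd 1"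
    using pencil_det_unit[OF U V UV Q QQ UQ] by (simp add: F\<^sub>0_def poly_pencil_det[OF Q CQcar[unfolded CQ]] CQ)
  then obtain u where u: "poly F\<^sub>0 0 * u = 1" by (metis dvdE)
  \<comment> \<open>on the image of \<open>E\<close> the matrix \<open>1 - C\<close> is \<open>- U\<close>\<close>
  have "pencil E (?C * E) 1 1 = pencil E (U * E) 0 1"
    unfolding CE using E U by (auto intro!: eq_matI simp: pencil_def algebra_simps simp del: index_mult_mat(1))
  then have "poly F\<^sub>1 1 dvd 1"
    using pencil_det_unit[OF U V UV E EE EU[symmetric]] by (simp add: F\<^sub>1_def poly_pencil_det[OF E CEcar])
  then obtain w where w: "poly F\<^sub>1 1 * w = 1" by (metis dvdE)
  define \<epsilon> where "\<epsilon> = first_col_poly n E"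
  have Q\<epsilon>: "first_col_poly n Q = 1 - \<epsilon>"
  proof -
    have "first_col_poly n Q = (\<Sum>i<n. (if i = 0 then 1 else 0) - monom (E $$ (i, 0)) i)"
      unfolding first_col_poly_def using E n
      by (intro sum.cong) (auto simp: Q_def diff_monom[symmetric] monom_0 one_pCons)
    then show ?thesis using n by (simp add: sum_subtractf \<epsilon>_def first_col_poly_def)
  qed
  have "h dvd F\<^sub>0 * (1 - \<epsilon>)" unfolding F\<^sub>0_def Q\<epsilon>[symmetric] by (rule companion_dvd_pencil_det[OF n m Q QQ CQc])
  then obtain g\<^sub>1 where g1: "F\<^sub>0 * (1 - \<epsilon>) = h * g\<^sub>1" ..
  have "h dvd F\<^sub>1 * \<epsilon>" unfolding F\<^sub>1_def \<epsilon>_def by (rule companion_dvd_pencil_det[OF n m E EE CEc])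
  then obtain g\<^sub>0 where g0: "F\<^sub>1 * \<epsilon> = h * g\<^sub>0" ..
  let ?I = "coeff (rank_poly Q) ` {..degree (rank_poly Q)}"
  have "\<exists>f\<^sub>0 f\<^sub>1. SRC_factorization e (Polynomial.smult e h) f\<^sub>0 f\<^sub>1" if "e \<in> ?I" for e
  proof -
    from that obtain i where e: "e = coeff (rank_poly Q) i" by blast
    have idem: "e * e = e" unfolding e using rank_poly_coeff_mult[OF Q QQ, of i i] by simp
    let ?h = "Polynomial.smult e h" and ?f\<^sub>0 = "Polynomial.smult e F\<^sub>0" and ?f\<^sub>1 = "Polynomial.smult e F\<^sub>1"
    have lh: "lead_coeff ?h = e"
      using m n by (intro lead_coeff_smult_eq[of n]) (auto simp: coeff_eq_0)
    have l0: "lead_coeff ?f\<^sub>0 = e"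
      unfolding e F\<^sub>0_def by (rule lead_coeff_smult_eq[of i]) (rule coeff_rank_component[OF Q CQcar QQ BQ])
    have hf: "?h = ?f\<^sub>0 * ?f\<^sub>1" unfolding hF by (simp add: idem mult.commute)
    have s: "Polynomial.smult e (Polynomial.smult e p) = Polynomial.smult e p" for p by (simp add: idem)
    \<comment> \<open>the product \<open>?h\<close> and the factor \<open>?f\<^sub>0\<close> both have leading coefficient \<open>e\<close>\<close>
    have l1: "lead_coeff ?f\<^sub>1 = e"
      by (rule corner_monic_cofactor[OF l0 s]) (simp only: hf[symmetric] lh)
    \<comment> \<open>over \<open>e R\<close>, cancelling \<open>F\<^sub>0\<close> from \<open>F\<^sub>0 (1 - \<epsilon>) = F\<^sub>0 F\<^sub>1 g\<^sub>1\<close> leaves \<open>1 - \<epsilon> = F\<^sub>1 g\<^sub>1\<close>\<close>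
    have "F\<^sub>0 * ((1 - \<epsilon>) - F\<^sub>1 * g\<^sub>1) = 0"
      using g1 unfolding hF by (simp add: algebra_simps)
    then have "?f\<^sub>0 * Polynomial.smult e ((1 - \<epsilon>) - F\<^sub>1 * g\<^sub>1) = 0"
      by (simp only: mult_smult_left mult_smult_right smult_0_right)
    then have c1: "Polynomial.smult e ((1 - \<epsilon>) - F\<^sub>1 * g\<^sub>1) = 0" by (rule corner_monic_cancel[OF l0 s])
    have "F\<^sub>1 * (\<epsilon> - F\<^sub>0 * g\<^sub>0) = 0"
      using g0 unfolding hF by (simp add: algebra_simps)
    then have "?f\<^sub>1 * Polynomial.smult e (\<epsilon> - F\<^sub>0 * g\<^sub>0) = 0"
      by (simp only: mult_smult_left mult_smult_right smult_0_right)
    then have c0: "Polynomial.smult e (\<epsilon> - F\<^sub>0 * g\<^sub>0) = 0" by (rule corner_monic_cancel[OF l1 s])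
    have "g\<^sub>0 * ?f\<^sub>0 + g\<^sub>1 * ?f\<^sub>1 = Polynomial.smult e 1 - Polynomial.smult e ((1 - \<epsilon>) - F\<^sub>1 * g\<^sub>1) - Polynomial.smult e (\<epsilon> - F\<^sub>0 * g\<^sub>0)"
      by (simp add: smult_diff_right smult_add_right algebra_simps)
    then have comax: "g\<^sub>0 * ?f\<^sub>0 + g\<^sub>1 * ?f\<^sub>1 = [:e:]" unfolding c0 c1 by (simp add: one_pCons)
    have unit: "\<exists>y. e * y = y \<and> poly (Polynomial.smult e F) c * y = e" if "poly F c * x = 1" for F c x
    proof (intro exI conjI)
      show "e * (e * x) = e * x" by (simp only: mult.assoc[symmetric] idem)
      have "poly (Polynomial.smult e F) c * (e * x) = (e * e) * (poly F c * x)"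
        by (simp only: poly_smult ac_simps)
      then show "poly (Polynomial.smult e F) c * (e * x) = e" by (simp only: that idem mult_1_right)
    qed
    have "SRC_factorization e ?h ?f\<^sub>0 ?f\<^sub>1"
      unfolding SRC_factorization_iff[OF idem]
      by (intro conjI s lh l0 l1 hf unit[OF u] unit[OF w] exI[of _ g\<^sub>0] exI[of _ g\<^sub>1] comax)
    then show ?thesis by blast
  qed
  then show ?thesis
    unfolding has_gSRC_factorization_def using complete_orthogonal_rank_idempotents[OF Q QQ] by blast
qed

theorem theorem7:
  fixes h :: "'a::comm_ring_1 poly" and n :: nat
  assumes "clean_ring (class_ring :: 'a ring)"
    and "n \<ge> 2"
    and "monic h"
    and "degree h = n"
  shows "((\<forall>A \<in> carrier_mat n n. char_poly A = h \<longrightarrow> strongly_clean_in (ring_mat TYPE('a) n ()) A)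
            \<longleftrightarrow> strongly_clean_in (ring_mat TYPE('a) n ()) (companion_mat h))
       \<and> (strongly_clean_in (ring_mat TYPE('a) n ()) (companion_mat h)
            \<longleftrightarrow> has_gSRC_factorization h)"
proof -
  have n: "n > 0" using assms(2) by simp
  have "strongly_clean_in (ring_mat TYPE('a) n ()) A"
    if "has_gSRC_factorization h" "A \<in> carrier_mat n n" "char_poly A = h" for A
    using strongly_clean_if_clean_variable_mod[OF that(2)] clean_variable_mod_if_gSRC[OF that(1)] that(3) by simp
  moreover have "companion_mat h \<in> carrier_mat n n" "char_poly (companion_mat h) = h"
    using companion_mat_carrier[of h] char_poly_companion_mat[OF assms(4) n assms(3)] assms(4) by auto
  moreover have "has_gSRC_factorization h"
    if "strongly_clean_in (ring_mat TYPE('a) n ()) (companion_mat h)"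
    by (rule gSRC_if_companion_strongly_clean[OF assms(4) n assms(3) that])
  ultimately show ?thesis by blast
qed

end
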